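(* Let $\alpha\in(0,1)$, $1\le p\le\infty$ and $X=\ell^p(\mathbb{C}^2)$. Let $$T_0=\begin{pmatrix}1&1\\-\alpha^2&1-2\alpha\end{pmatrix},\qquad T_1=\begin{pmatrix}0&-1\\0&0\end{pmatrix},$$ and let $T\in\mathcal{B}(X)$ be given by $T(x_k)_{k\in\mathbb{Z}}=(T_0x_k+T_1x_{k-1})_{k\in\mathbb{Z}}$. For $x_0\in X$ let $x(n)=T^nx_0$, $n\ge0$, be the solution of $x(n+1)=Tx(n)$, $n\ge0$, $x(0)=x_0$. Write $x_k(n)=(y_k(n),v_k(n))^{\mathsf T}$ and let $y_0=(y_k(0))_{k\in\mathbb{Z}}\in\ell^p(\mathbb{C})$ be the sequence of first components of the initial data $x_0$. Let $S$ be the right shift on $\ell^p(\mathbb{C})$. Then the following hold. (a) The solution converges to a limit in the norm of $X$ if and only if there exists $c\in\mathbb{C}$ such that the constant sequence $y$ with entry $c$ is an element of $\ell^p(\mathbb{C})$ and $$\bigg\|\frac1n\sum_{j=1}^nS^jy_0-y\bigg\|_{\ell^p(\mathbb{C})}\to0,\qquad n\to\infty.\tag{$*$}$$ Moreover, if this is the case then $\|x(n)-z\|_X\to0$ as $n\to\infty$, where $z\in X$ is the constant sequence all of whose entries equal $(c,-\alpha c/2)^{\mathsf T}$. In particular, all initial vectors $x_0\in X$ lead to convergence if and only if $1<p<\infty$, and if $1\le p<\infty$ then the only possible candidate for $c$ is $0$. (b) If $y_0\in\ell^p(\mathbb{C})$ is such that the convergence in $( * )$ holds with rate $O(n^{-1})$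 as $n\to\infty$ (for some $y$ as in (a)), then, with $z$ as in (a), $\|x(n)-z\|_X=O(n^{-1/2})$ as $n\to\infty$. (c) For all $x_0\in X$ we have $\|x(n+1)-x(n)\|_X=O(n^{-1/2})$ as $n\to\infty$. Furthermore, the rates in (b) and (c) are optimal, in the sense that if in (b) or in (c) the rate $n^{-1/2}$ were replaced by $r_n$ for some sequence $r_n>0$, $n\ge1$, with $r_n=o(n^{-1/2})$ as $n\to\infty$, then the corresponding statement would become false.
   Context: For $m\in\mathbb{N}$, $\ell^p(\mathbb{C}^m)$ denotes the Banach space of doubly infinite sequences $x=(x_k)_{k\in\mathbb{Z}}$ with $x_k\in\mathbb{C}^m$ (Euclidean norm) and norm $\|x\|=(\sum_{k\in\mathbb{Z}}\|x_k\|^p)^{1/p}$ if $1\le p<\infty$, $\|x\|=\sup_{k\in\mathbb{Z}}\|x_k\|$ if $p=\infty$. $\mathcal{B}(X)$ is the space of bounded linear operators on $X$. The right shift is $S(y_k)=(y_{k-1})$. (Interpretation: $y_k(n)$ is the discrepancy between the target and actual separation of agents $k$ and $k-1$ at time $n$, and $v_k(n)$ is the velocity of agent $k$.) *)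

theory Defs
  imports "HOL-Analysis.Analysis" "HOL-Library.Landau_Symbols"
begin

text \<open>Two-sided sequence spaces for an extended real exponent \<open>1 \<le> p \<le> \<infinity>\<close>. On
  \<^typ>\<open>complex^2\<close> the library norm is the Euclidean norm. The value of \<open>lp_norm p x\<close> is
  meaningful only for \<open>x \<in> lp p\<close>.\<close>

definition lp :: "ereal \<Rightarrow> (int \<Rightarrow> 'a::real_normed_vector) set" where
  "lp p = {x. if p = \<infinity> then bounded (range x)
              else (\<lambda>k. norm (x k) powr real_of_ereal p) summable_on UNIV}"

definition lp_norm :: "ereal \<Rightarrow> (int \<Rightarrow> 'a::real_normed_vector) \<Rightarrow> real" where
  "lp_norm p x = (if p = \<infinity> then (SUP k. norm (x k))
     else (\<Sum>\<^sub>\<infinity>k. norm (x k) powr real_of_ereal p) powr (1 / real_of_ereal p))"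

definition lp_tendsto ::
    "ereal \<Rightarrow> (nat \<Rightarrow> int \<Rightarrow> 'a::real_normed_vector) \<Rightarrow> (int \<Rightarrow> 'a) \<Rightarrow> bool" where
  "lp_tendsto p u w \<longleftrightarrow> w \<in> lp p \<and> (\<lambda>n. lp_norm p (\<lambda>k. u n k - w k)) \<longlonglongrightarrow> 0"

definition right_shift :: "(int \<Rightarrow> 'a) \<Rightarrow> int \<Rightarrow> 'a" where
  "right_shift y = (\<lambda>k. y (k - 1))"

definition shift_mean :: "(int \<Rightarrow> complex) \<Rightarrow> nat \<Rightarrow> int \<Rightarrow> complex" where
  "shift_mean y n = (\<lambda>k. (1 / of_nat n) * (\<Sum>j=1..n. (right_shift ^^ j) y k))"

definition T0 :: "real \<Rightarrow> complex^2^2" where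
  "T0 \<alpha> = vector [vector [1, 1],
                  vector [- (of_real \<alpha>)\<^sup>2, 1 - 2 * of_real \<alpha>]]"

definition T1 :: "complex^2^2" where
  "T1 = vector [vector [0, -1],
                vector [0, 0]]"

definition T_op :: "real \<Rightarrow> (int \<Rightarrow> complex^2) \<Rightarrow> int \<Rightarrow> complex^2" where
  "T_op \<alpha> x = (\<lambda>k. T0 \<alpha> *v x k + T1 *v x (k - 1))"

definition solution :: "real \<Rightarrow> (int \<Rightarrow> complex^2) \<Rightarrow> nat \<Rightarrow> int \<Rightarrow> complex^2" where
  "solution \<alpha> x0 n = (T_op \<alpha> ^^ n) x0"

definition first_component :: "(int \<Rightarrow> complex^2) \<Rightarrow> int \<Rightarrow> complex" where
  "first_component x = (\<lambda>k. x k $ 1)"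

definition limit_state :: "real \<Rightarrow> complex \<Rightarrow> int \<Rightarrow> complex^2" where
  "limit_state \<alpha> c = (\<lambda>k. vector [c, - of_real \<alpha> * c / 2])"

text \<open>The remaining facts justify that the definitions above stay inside the sequence spaces; in
  particular \<open>T_op \<alpha>\<close> is a bounded linear operator on \<open>lp p\<close>.\<close>

lemma lp_dominated:
  fixes u :: "int \<Rightarrow> 'a::real_normed_vector" and x :: "int \<Rightarrow> 'b::real_normed_vector"
    and y :: "int \<Rightarrow> 'c::real_normed_vector"
  assumes p: "1 \<le> p" and x: "x \<in> lp p" and y: "y \<in> lp p" and M: "0 \<le> M"
    and le: "\<And>k. norm (u k) \<le> M * (norm (x k) + norm (y k))"
    and xN: "lp_norm p x \<le> N" and yN: "lp_norm p y \<le> N"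
  shows "u \<in> lp p" and "lp_norm p u \<le> 4 * M * N"
proof -
  have "u \<in> lp p \<and> lp_norm p u \<le> 4 * M * N"
  proof (cases "p = \<infinity>")
    case True
    have bx: "bdd_above (range (\<lambda>k. norm (x k)))" and by': "bdd_above (range (\<lambda>k. norm (y k)))"
      using x y True by (auto simp: lp_def bounded_iff bdd_above_def)
    have nx: "norm (x k) \<le> N" and ny: "norm (y k) \<le> N" for k
      using cSUP_upper[OF UNIV_I bx, of k] cSUP_upper[OF UNIV_I by', of k] xN yN True
      by (auto simp: lp_norm_def)
    have N0: "0 \<le> N" using nx[of 0] norm_ge_zero order_trans by blast
    have u: "norm (u k) \<le> 4 * M * N" for k
    proof -
      have "M * (norm (x k) + norm (y k)) \<le> M * (4 * N)"
        using nx[of k] ny[of k] N0 M by (intro mult_left_mono) auto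
      then show ?thesis using le[of k] by simp
    qed
    show ?thesis using u True by (auto simp: lp_def lp_norm_def bounded_iff intro!: cSUP_least)
  next
    case False
    define q where "q = real_of_ereal p"
    have q: "1 \<le> q" using p False by (cases p) (auto simp: q_def one_ereal_def)
    let ?f = "\<lambda>k. norm (u k) powr q"
    let ?a = "\<lambda>k. norm (x k) powr q" and ?b = "\<lambda>k. norm (y k) powr q"
    have sa: "?a summable_on UNIV" and sb: "?b summable_on UNIV"
      using x y False by (auto simp: lp_def q_def)
    have a0: "0 \<le> infsum ?a UNIV" and b0: "0 \<le> infsum ?b UNIV"
      by (auto intro!: infsum_nonneg)
    have xN': "infsum ?a UNIV powr (1/q) \<le> N" and yN': "infsum ?b UNIV powr (1/q) \<le> N"
      using xN yN False by (auto simp: lp_norm_def q_def)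
    have N0: "0 \<le> N" using xN' powr_ge_zero order_trans by blast
    have root: "t \<le> N powr q" if "0 \<le> t" "t powr (1/q) \<le> N" for t
      using powr_mono2[of q "t powr (1/q)" N] that q by (auto simp: powr_powr)
    let ?g = "\<lambda>k. (2 * M) powr q * (?a k + ?b k)"
    have sg: "?g summable_on UNIV"
      by (intro summable_on_cmult_right summable_on_add sa sb)
    have fg: "?f k \<le> ?g k" for k
    proof -
      let ?m = "max (norm (x k)) (norm (y k))"
      have "norm (u k) \<le> (2 * M) * ?m"
      proof -
        have "M * (norm (x k) + norm (y k)) \<le> M * (2 * ?m)"
          using M by (intro mult_left_mono) auto
        then show ?thesis using le[of k] by simp
      qed
      then have "?f k \<le> ((2 * M) * ?m) powr q" using q by (intro powr_mono2) auto
      also have "\<dots> = (2 * M) powr q * ?m powr q" using M by (simp add: powr_mult)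
      also have "\<dots> \<le> ?g k" by (intro mult_left_mono) (auto simp: max_def)
      finally show ?thesis .
    qed
    have sf: "?f summable_on UNIV"
      by (rule summable_on_comparison_test[OF sg]) (use fg in auto)
    have "infsum ?f UNIV \<le> infsum ?g UNIV"
      by (rule infsum_mono[OF sf sg]) (use fg in auto)
    also have "\<dots> = (2 * M) powr q * (infsum ?a UNIV + infsum ?b UNIV)"
      by (subst infsum_cmult_right') (simp add: infsum_add[OF sa sb])
    also have "\<dots> \<le> (2 * M) powr q * (2 * N powr q)"
      using root[OF a0 xN'] root[OF b0 yN'] by (intro mult_left_mono) auto
    also have "\<dots> \<le> (2 * M) powr q * (2 powr q * N powr q)"
      using powr_mono[of 1 q 2] q by (intro mult_left_mono mult_right_mono) auto
    also have "\<dots> = (4 * M * N) powr q"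
      using M N0 by (simp add: powr_mult[symmetric] mult.assoc)
    finally have "infsum ?f UNIV powr (1/q) \<le> ((4 * M * N) powr q) powr (1/q)"
      using q by (intro powr_mono2) (auto intro!: infsum_nonneg)
    also have "\<dots> = 4 * M * N" using q M N0 by (simp add: powr_powr)
    finally show ?thesis using sf False by (auto simp: lp_def lp_norm_def q_def)
  qed
  then show "u \<in> lp p" "lp_norm p u \<le> 4 * M * N" by auto
qed

lemma lp_add: "1 \<le> p \<Longrightarrow> x \<in> lp p \<Longrightarrow> y \<in> lp p \<Longrightarrow> (\<lambda>k. x k + y k) \<in> lp p"
  by (rule lp_dominated(1)[of p x y 1 _ "max (lp_norm p x) (lp_norm p y)"])
    (auto intro: norm_triangle_ineq)

lemma lp_diff: "1 \<le> p \<Longrightarrow> x \<in> lp p \<Longrightarrow> y \<in> lp p \<Longrightarrow> (\<lambda>k. x k - y k) \<in> lp p"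
  by (rule lp_dominated(1)[of p x y 1 _ "max (lp_norm p x) (lp_norm p y)"])
    (auto intro: norm_triangle_ineq4)

lemma lp_mult: "1 \<le> p \<Longrightarrow> y \<in> lp p \<Longrightarrow> (\<lambda>k. c * y k) \<in> lp p" for c :: complex
  by (rule lp_dominated(1)[of p y y "norm c" _ "lp_norm p y"])
    (auto simp: norm_mult intro!: mult_left_mono)

lemma lp_first_component: "1 \<le> p \<Longrightarrow> x \<in> lp p \<Longrightarrow> first_component x \<in> lp p"
proof (rule lp_dominated(1)[of p x x 1 _ "lp_norm p x"])
  show "norm (first_component x k) \<le> 1 * (norm (x k) + norm (x k))" for k
    using order_trans[OF Finite_Cartesian_Product.norm_nth_le[of "x k" 1],
        of "norm (x k) + norm (x k)"] norm_ge_zero[of "x k"]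
    by (simp add: first_component_def)
qed auto

lemma lp_norm_right_shift: "lp_norm p (right_shift x) = lp_norm p x"
proof -
  have b: "bij (\<lambda>k::int. k - 1)" by (rule bij_betw_byWitness[where f' = "\<lambda>k. k + 1"]) auto
  have r: "range (\<lambda>k. norm (x (k - 1))) = range (\<lambda>k. norm (x k))"
    using bij_is_surj[OF b] by (metis image_image)
  show ?thesis
    using infsum_reindex_bij_betw[OF b, of "\<lambda>k. norm (x k) powr real_of_ereal p"] r
    by (simp add: lp_norm_def right_shift_def)
qed

lemma lp_right_shift: "x \<in> lp p \<Longrightarrow> right_shift x \<in> lp p"
proof -
  have b: "bij (\<lambda>k::int. k - 1)" by (rule bij_betw_byWitness[where f' = "\<lambda>k. k + 1"]) auto
  show "x \<in> lp p \<Longrightarrow> right_shift x \<in> lp p"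
    using summable_on_reindex_bij_betw[OF b, of "\<lambda>k. norm (x k) powr real_of_ereal p"]
    by (auto simp: lp_def right_shift_def bounded_iff split: if_splits)
qed

lemma lp_shift_mean:
  assumes p: "1 \<le> p" and y: "y \<in> lp p"
  shows "shift_mean y n \<in> lp p"
proof -
  have pow: "(right_shift ^^ j) y \<in> lp p" for j
    by (induction j) (auto simp: y lp_right_shift)
  have zero: "(\<lambda>k. 0 * y k) \<in> lp p" by (rule lp_mult[OF p y])
  have "(\<lambda>k. \<Sum>j=1..n. (right_shift ^^ j) y k) \<in> lp p"
    using zero by (induction n) (auto intro!: lp_add p lp_right_shift pow simp: add.commute)
  then show ?thesis unfolding shift_mean_def by (rule lp_mult[OF p])
qed

lemma T_op_linear:
  "T_op \<alpha> (\<lambda>k. x k + y k) = (\<lambda>k. T_op \<alpha> x k + T_op \<alpha> y k)"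
  "T_op \<alpha> (\<lambda>k. c *s x k) = (\<lambda>k. c *s T_op \<alpha> x k)"
  by (auto simp: T_op_def matrix_vector_right_distrib vector_scalar_commute vector_add_ldistrib)

lemma T_op_bounded:
  assumes p: "1 \<le> p"
  shows "\<exists>C. \<forall>x \<in> lp p. T_op \<alpha> x \<in> lp p \<and> lp_norm p (T_op \<alpha> x) \<le> C * lp_norm p x"
proof -
  have bl: "bounded_linear (\<lambda>v. A *v v)" for A :: "complex^2^2"
    by (simp add: linear_conv_bounded_linear[symmetric] matrix_vector_mul_linear)
  obtain K0 where K0: "0 \<le> K0" "\<And>v. norm (T0 \<alpha> *v v) \<le> norm v * K0"
    using bounded_linear.nonneg_bounded[OF bl] by metis
  obtain K1 where K1: "0 \<le> K1" "\<And>v. norm (T1 *v v) \<le> norm v * K1"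
    using bounded_linear.nonneg_bounded[OF bl] by metis
  define M where "M = max K0 K1"
  have M: "0 \<le> M" "norm (T0 \<alpha> *v v) \<le> M * norm v" "norm (T1 *v v) \<le> M * norm v" for v
    using K0(1) order_trans[OF K0(2)[of v] mult_left_mono[of K0 M "norm v"]]
      order_trans[OF K1(2)[of v] mult_left_mono[of K1 M "norm v"]]
    by (auto simp: M_def mult.commute)
  have le: "norm (T_op \<alpha> x k) \<le> M * (norm (x k) + norm (right_shift x k))" for x k
    using norm_triangle_ineq[of "T0 \<alpha> *v x k" "T1 *v x (k - 1)"] M(2)[of "x k"] M(3)[of "x (k - 1)"]
    by (simp add: T_op_def right_shift_def ring_distribs)
  have "T_op \<alpha> x \<in> lp p \<and> lp_norm p (T_op \<alpha> x) \<le> (4 * M) * lp_norm p x" if x: "x \<in> lp p" for x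
    using lp_dominated[OF p x lp_right_shift[OF x] M(1) le, of "lp_norm p x"]
    by (auto simp: lp_norm_right_shift)
  then show ?thesis by blast
qed

lemma lp_solution: "1 \<le> p \<Longrightarrow> x0 \<in> lp p \<Longrightarrow> solution \<alpha> x0 n \<in> lp p"
  unfolding solution_def by (induction n) (use T_op_bounded in auto)

end

theory Submission
  imports Defs "HOL-Analysis.Weierstrass_Theorems" "HOL-Real_Asymp.Real_Asymp"
begin

text \<open>The operator \<open>V = (T - (1 - \<alpha>)) / \<alpha>\<close> (\<open>half_shift\<close> below) is a square root of the shift, so
  \<open>T^n = ((1 - \<alpha>) + \<alpha> V)^n\<close> is an average of the powers of \<open>V\<close> with binomial weights. If the
  partial sums of \<open>V^j x\<close> are bounded, summation by parts bounds \<open>T^n x\<close> by the total variation of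
  the weights, which the binomial variance shows to be of order \<open>n^(-1/2)\<close>. Boundedness of these sums
  only depends on the first component of \<open>x\<close>, which gives (b), (c) and, after splitting off a
  Cesaro mean of the first component, (a). For optimality, Chebyshev's inequality shows that at time
  \<open>n\<close> an initial state living on a block of length about \<open>sqrt n\<close> attains the rate; superposing
  far apart blocks for a sparse sequence of times defeats every faster rate.\<close>

section \<open>Two-sided sequence spaces\<close>

text \<open>The square root comes from Cayley-Hamilton: with the shift S replaced by a scalar z, T
  is a 2x2 matrix with trace 2 (1 - \<alpha>) and determinant (1 - \<alpha>)^2 - \<alpha>^2 z, so (T
  - (1 - \<alpha>))^2 = \<alpha>^2 z. Even powers of V are therefore shifts and odd powers are
  shifts of V: they stay bounded but do not decay, so decay of T^n x must come from cancellation
  among the V^j x. Grouping their sums in pairs gives 1 + V applied to sums of shifts, and 1 + V has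
  rows (2, (1 - S) / \<alpha>) and (-\<alpha>, 0). The second component enters only through a
  telescoping difference, which is why the first component decides everything. For optimality, the
  solution started from a block is measured by its sum over a window of about sqrt n sites: the sum
  is a binomial mass that does not involve p, and Hoelder converts it into a norm. Superposing
  blocks costs a weight 2^(-j) on the j-th one; choosing times at which the proposed rate is at most
  4^(-j) n^(-1/2) absorbs this loss.\<close>

lemma convex_on_powr_nonneg:
  assumes "1 \<le> q"
  shows "convex_on {0..} (\<lambda>x::real. x powr q)"
proof (intro convex_onI)
  fix t x y :: real
  assume t: "0 < t" "t < 1" and xy: "x \<in> {0..}" "y \<in> {0..}"
  \<comment> \<open>With one endpoint equal to 0, convexity reduces to
    \<open>s powr q \<le> s\<close> for a weight \<open>s\<close> in (0,1).\<close>
  have zero: "(s * z) powr q \<le> s * z powr q" if "0 < s" "s < 1" "0 \<le> z" for s z :: real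
  proof -
    have "s powr q \<le> s"
      using that assms powr_mono'[of 1 q s] by simp
    then show ?thesis
      using that by (simp add: powr_mult mult_right_mono)
  qed
  show "((1 - t) *\<^sub>R x + t *\<^sub>R y) powr q \<le> (1 - t) * x powr q + t * y powr q"
  proof (cases "x = 0 \<or> y = 0")
    case True
    then show ?thesis
      using zero[of t y] zero[of "1 - t" x] t xy assms by auto
  next
    case False
    then show ?thesis
      using convex_onD[OF powr_convex[OF assms], of t x y] t xy by auto
  qed
qed simp

text \<open>Membership and bound are kept together because \<open>lp_norm\<close> outside
  \<open>lp p\<close> is a meaningless default value. Explicit bounds then compose through sums and
  shifts without computing any norm.\<close>

definition lp_le :: "ereal \<Rightarrow> real \<Rightarrow> (int \<Rightarrow> 'a::real_normed_vector) \<Rightarrow> bool" where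
  "lp_le p K x \<longleftrightarrow> x \<in> lp p \<and> lp_norm p x \<le> K"

lemma lp_exponent_cases:
  assumes "1 \<le> p"
  obtains "p = \<infinity>" | q where "p = ereal q" "1 \<le> q"
  using assms by (cases p) (auto simp: one_ereal_def)

lemma bdd_above_range_norm: "x \<in> lp \<infinity> \<Longrightarrow> bdd_above (range (\<lambda>k. norm (x k)))"
  by (auto simp: lp_def bounded_iff bdd_above_def)

lemma lp_norm_nonneg: "x \<in> lp p \<Longrightarrow> 0 \<le> lp_norm p x"
proof (cases "p = \<infinity>")
  case True
  assume "x \<in> lp p"
  then have "norm (x 0) \<le> (SUP k. norm (x k))"
    by (intro cSUP_upper bdd_above_range_norm) (auto simp: True)
  from order_trans[OF norm_ge_zero this] show ?thesis
    unfolding lp_norm_def by (simp only: True if_True refl)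
qed (simp add: lp_norm_def)

lemma lp_le_nonneg: "lp_le p K x \<Longrightarrow> 0 \<le> K"
  unfolding lp_le_def using lp_norm_nonneg order_trans by blast

lemma lp_le_lp_norm: "x \<in> lp p \<Longrightarrow> lp_le p (lp_norm p x) x"
  by (simp add: lp_le_def)

lemma lp_le_mono: "lp_le p K x \<Longrightarrow> K \<le> L \<Longrightarrow> lp_le p L x"
  by (auto simp: lp_le_def)

lemma lp_le_infinity:
  assumes "0 \<le> K"
  shows "lp_le \<infinity> K x \<longleftrightarrow> (\<forall>k. norm (x k) \<le> K)"
proof
  assume l: "lp_le \<infinity> K x"
  show "\<forall>k. norm (x k) \<le> K"
  proof
    fix k
    have "norm (x k) \<le> (SUP k. norm (x k))"
      using l by (intro cSUP_upper bdd_above_range_norm) (auto simp: lp_le_def)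
    then show "norm (x k) \<le> K"
      using l by (simp add: lp_le_def lp_norm_def)
  qed
next
  assume "\<forall>k. norm (x k) \<le> K"
  then show "lp_le \<infinity> K x"
    by (auto simp: lp_le_def lp_def lp_norm_def bounded_iff intro!: cSUP_least)
qed

text \<open>The terms are nonnegative, so finite partial sums carry all the information; estimates
  for finite exponents become estimates of finite sums.\<close>

lemma lp_le_ereal:
  assumes q: "1 \<le> q" and K: "0 \<le> K"
  shows "lp_le (ereal q) K x \<longleftrightarrow>
    (\<forall>F. finite F \<longrightarrow> (\<Sum>k\<in>F. norm (x k) powr q) \<le> K powr q)"
proof
  assume l: "lp_le (ereal q) K x"
  let ?f = "\<lambda>k. norm (x k) powr q"
  have s: "?f summable_on UNIV" and n: "infsum ?f UNIV powr (1 / q) \<le> K"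
    using l by (auto simp: lp_le_def lp_def lp_norm_def)
  have "(infsum ?f UNIV powr (1 / q)) powr q \<le> K powr q"
    using q n by (intro powr_mono2) auto
  then have "infsum ?f UNIV \<le> K powr q"
    using q by (simp add: powr_powr infsum_nonneg)
  then show "\<forall>F. finite F \<longrightarrow> (\<Sum>k\<in>F. ?f k) \<le> K powr q"
    using finite_sum_le_infsum[OF s] by (meson order_trans powr_ge_zero subset_UNIV)
next
  let ?f = "\<lambda>k. norm (x k) powr q"
  assume F: "\<forall>F. finite F \<longrightarrow> (\<Sum>k\<in>F. ?f k) \<le> K powr q"
  have s: "?f summable_on UNIV"
    using F by (intro nonneg_bdd_above_summable_on) (auto simp: bdd_above_def)
  have "infsum ?f UNIV \<le> K powr q"
    using F by (intro infsum_le_finite_sums s) auto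
  then have "infsum ?f UNIV powr (1 / q) \<le> (K powr q) powr (1 / q)"
    using q by (intro powr_mono2) (auto intro: infsum_nonneg)
  then show "lp_le (ereal q) K x"
    using s q K by (simp add: lp_le_def lp_def lp_norm_def powr_powr)
qed

section \<open>Norm bounds under linear operations\<close>

lemma lp_le_scale:
  fixes x :: "int \<Rightarrow> 'a::real_normed_vector" and u :: "int \<Rightarrow> 'b::real_normed_vector"
  assumes p: "1 \<le> p" and x: "lp_le p K x" and C: "0 \<le> C"
    and le: "\<And>k. norm (u k) \<le> C * norm (x k)"
  shows "lp_le p (C * K) u"
  using p
proof (cases rule: lp_exponent_cases)
  case 1
  have "norm (u k) \<le> C * K" for k
    using x lp_le_nonneg[OF x] order_trans[OF le[of k] mult_left_mono[OF _ C]]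
    by (auto simp: 1 lp_le_infinity)
  then show ?thesis
    using C lp_le_nonneg[OF x] by (simp add: 1 lp_le_infinity)
next
  case (2 q)
  have K: "0 \<le> K" using lp_le_nonneg[OF x] .
  have "(\<Sum>k\<in>F. norm (u k) powr q) \<le> (C * K) powr q" if "finite F" for F
  proof -
    have "(\<Sum>k\<in>F. norm (u k) powr q) \<le> (\<Sum>k\<in>F. C powr q * norm (x k) powr q)"
      using 2 C le by (intro sum_mono) (auto simp: powr_mult[symmetric] intro!: powr_mono2)
    also have "\<dots> \<le> C powr q * K powr q"
      using x that K 2 by (auto simp: lp_le_ereal sum_distrib_left[symmetric] intro!: mult_left_mono)
    finally show ?thesis using C K by (simp add: powr_mult)
  qed
  then show ?thesis using 2 C K by (simp add: lp_le_ereal)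
qed

text \<open>Minkowski's inequality: \<open>x + y\<close> is \<open>K + L\<close> times a convex
  combination of the normalised sequences \<open>x / K\<close> and \<open>y / L\<close>, to which
  convexity of the power applies entrywise. The constant 1, sharper than in
  \<open>lp_dominated\<close>, is what allows sums of arbitrarily many terms later.\<close>

lemma lp_le_add_pos:
  fixes x y :: "int \<Rightarrow> 'a::real_normed_vector"
  assumes p: "1 \<le> p" and x: "lp_le p K x" and y: "lp_le p L y" and K: "0 < K" and L: "0 < L"
  shows "lp_le p (K + L) (\<lambda>k. x k + y k)"
  using p
proof (cases rule: lp_exponent_cases)
  case 1
  then show ?thesis
    using x y K L by (auto simp: lp_le_infinity intro: norm_triangle_mono)
next
  case (2 q)
  define t where "t = L / (K + L)"
  have t: "0 \<le> t" "t \<le> 1" "1 - t = K / (K + L)"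
    using K L by (auto simp: t_def field_simps)
  have pw: "norm (x k + y k) powr q
      \<le> (K + L) powr q * ((1 - t) * (norm (x k) / K) powr q + t * (norm (y k) / L) powr q)" for k
  proof -
    have "norm (x k + y k) \<le> norm (x k) + norm (y k)" by (rule norm_triangle_ineq)
    also have "\<dots> = (K + L) * ((1 - t) * (norm (x k) / K) + t * (norm (y k) / L))"
    proof -
      have "(K + L) * (1 - t) = K" "(K + L) * t = L"
        using K L unfolding t(3) by (simp_all add: t_def)
      then show ?thesis
        using K L by (simp add: distrib_left mult.assoc[symmetric])
    qed
    finally have "norm (x k + y k) powr q \<le> \<dots> powr q"
      using 2 by (intro powr_mono2) auto
    also have "\<dots> = (K + L) powr q * ((1 - t) * (norm (x k) / K) + t * (norm (y k) / L)) powr q"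
      using K L t by (intro powr_mult)
    also have "\<dots> \<le> (K + L) powr q * ((1 - t) * (norm (x k) / K) powr q + t * (norm (y k) / L) powr q)"
      using convex_onD[OF convex_on_powr_nonneg[OF 2(2)], of t "norm (x k) / K" "norm (y k) / L"]
        K L t by (intro mult_left_mono) auto
    finally show ?thesis .
  qed
  have part: "(\<Sum>k\<in>F. (norm (z k) / M) powr q) \<le> 1"
    if "finite F" "lp_le p M z" "0 < M" for F M and z :: "int \<Rightarrow> 'a"
  proof -
    have "(\<Sum>k\<in>F. (norm (z k) / M) powr q) = (\<Sum>k\<in>F. norm (z k) powr q) / M powr q"
      using that by (simp add: powr_divide sum_divide_distrib)
    also have "\<dots> \<le> 1"
      using that 2 by (simp add: lp_le_ereal divide_le_eq_1)
    finally show ?thesis .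
  qed
  have "(\<Sum>k\<in>F. norm (x k + y k) powr q) \<le> (K + L) powr q" if F: "finite F" for F
  proof -
    have "(\<Sum>k\<in>F. norm (x k + y k) powr q)
        \<le> (\<Sum>k\<in>F. (K + L) powr q * ((1 - t) * (norm (x k) / K) powr q + t * (norm (y k) / L) powr q))"
      by (intro sum_mono pw)
    also have "\<dots> = (K + L) powr q * ((1 - t) * (\<Sum>k\<in>F. (norm (x k) / K) powr q)
        + t * (\<Sum>k\<in>F. (norm (y k) / L) powr q))"
      by (simp add: sum_distrib_left sum.distrib distrib_left)
    also have "\<dots> \<le> (K + L) powr q * ((1 - t) * 1 + t * 1)"
      using part[OF F x K] part[OF F y L] t
      by (intro mult_left_mono add_mono) auto
    finally show ?thesis by simp
  qed
  then show ?thesis using 2 K L by (simp add: lp_le_ereal)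
qed

lemma lp_le_add:
  fixes x y :: "int \<Rightarrow> 'a::real_normed_vector"
  assumes p: "1 \<le> p" and x: "lp_le p K x" and y: "lp_le p L y"
  shows "lp_le p (K + L) (\<lambda>k. x k + y k)"
proof -
  \<comment> \<open>Enlarging each bound by \<open>e / 2\<close> makes it positive, so the
    normalisation is available.\<close>
  have "lp_norm p (\<lambda>k. x k + y k) \<le> K + L + e" if e: "0 < e" for e
    using lp_le_add_pos[OF p lp_le_mono[OF x] lp_le_mono[OF y], of "K + e / 2" "L + e / 2"]
      e lp_le_nonneg[OF x] lp_le_nonneg[OF y] by (auto simp: lp_le_def)
  moreover have "(\<lambda>k. x k + y k) \<in> lp p"
    using p x y by (auto simp: lp_le_def intro: lp_add)
  ultimately show ?thesis
    unfolding lp_le_def by (blast intro: field_le_epsilon)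
qed

lemma lp_le_zero: "1 \<le> p \<Longrightarrow> lp_le p 0 (\<lambda>k. 0)"
  by (erule lp_exponent_cases) (auto simp: lp_le_infinity lp_le_ereal)

lemma zero_in_lp: "1 \<le> p \<Longrightarrow> (\<lambda>k. 0) \<in> lp p"
  using lp_le_zero unfolding lp_le_def by blast

lemma lp_le_uminus: "1 \<le> p \<Longrightarrow> lp_le p K x \<Longrightarrow> lp_le p K (\<lambda>k. - x k)"
  using lp_le_scale[of p K x 1 "\<lambda>k. - x k"] by simp

lemma lp_le_diff:
  "1 \<le> p \<Longrightarrow> lp_le p K x \<Longrightarrow> lp_le p L y \<Longrightarrow> lp_le p (K + L) (\<lambda>k. x k - y k)"
  using lp_le_add[OF _ _ lp_le_uminus, of p K x L y] by simp

lemma lp_le_scaleR: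
  "1 \<le> p \<Longrightarrow> lp_le p K x \<Longrightarrow> lp_le p (\<bar>c\<bar> * K) (\<lambda>k. c *\<^sub>R x k)"
  by (erule lp_le_scale) auto

lemma lp_le_mult:
  fixes x :: "int \<Rightarrow> complex"
  shows "1 \<le> p \<Longrightarrow> lp_le p K x \<Longrightarrow> lp_le p (norm c * K) (\<lambda>k. c * x k)"
  by (erule lp_le_scale) (auto simp: norm_mult)

lemma lp_le_sum:
  fixes f :: "'i \<Rightarrow> int \<Rightarrow> 'a::real_normed_vector"
  assumes p: "1 \<le> p" and f: "\<And>i. i \<in> A \<Longrightarrow> lp_le p (K i) (f i)"
  shows "lp_le p (sum K A) (\<lambda>k. \<Sum>i\<in>A. f i k)"
  using f by (induction A rule: infinite_finite_induct) (auto intro!: lp_le_add lp_le_zero p)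

lemma lp_le_shift:
  assumes p: "1 \<le> p" and x: "lp_le p K x"
  shows "lp_le p K (\<lambda>k. x (k - m))"
  using p
proof (cases rule: lp_exponent_cases)
  case 1
  then show ?thesis using x lp_le_nonneg[OF x] by (simp add: lp_le_infinity)
next
  case (2 q)
  have K: "0 \<le> K" using lp_le_nonneg[OF x] .
  have "(\<Sum>k\<in>F. norm (x (k - m)) powr q) \<le> K powr q" if "finite F" for F
  proof -
    have "(\<Sum>k\<in>F. norm (x (k - m)) powr q) = (\<Sum>k\<in>(\<lambda>k. k - m) ` F. norm (x k) powr q)"
      by (subst sum.reindex) (auto simp: inj_on_def)
    then show ?thesis using x that 2 K by (simp add: lp_le_ereal)
  qed
  then show ?thesis using 2 K by (simp add: lp_le_ereal)
qed

text \<open>Hoelder against an indicator, obtained from Jensen with equal weights. For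
  \<open>p = \<infinity>\<close> the value \<open>real_of_ereal p\<close> is 0 and division by zero
  gives 0, so the exponent is 1, as it should be. Lower bounds for sums thereby become lower bounds
  for norms.\<close>

lemma lp_le_sum_norm:
  assumes p: "1 \<le> p" and x: "lp_le p K x" and I: "finite I" "I \<noteq> {}"
  shows "(\<Sum>k\<in>I. norm (x k)) \<le> real (card I) powr (1 - 1 / real_of_ereal p) * K"
  using p
proof (cases rule: lp_exponent_cases)
  case 1
  then have "(\<Sum>k\<in>I. norm (x k)) \<le> real (card I) * K"
    using x lp_le_nonneg[OF x] by (intro sum_bounded_above) (simp add: lp_le_infinity)
  then show ?thesis using 1 by simp
next
  case (2 q)
  define M where "M = real (card I)"
  have M: "0 < M" using I by (simp add: M_def card_gt_0_iff)
  have K: "0 \<le> K" using lp_le_nonneg[OF x] .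
  have "(\<Sum>k\<in>I. (1 / M) *\<^sub>R norm (x k)) powr q \<le> (\<Sum>k\<in>I. (1 / M) * norm (x k) powr q)"
    using I M by (intro convex_on_sum[OF _ _ convex_on_powr_nonneg[OF 2(2)]]) (auto simp: M_def)
  also have "\<dots> \<le> (1 / M) * K powr q"
    unfolding sum_distrib_left[symmetric]
    using x I 2 K M by (intro mult_left_mono) (auto simp: lp_le_ereal)
  finally have "((\<Sum>k\<in>I. norm (x k)) / M) powr q \<le> (1 / M) * K powr q"
    by (simp add: sum_divide_distrib)
  then have "(((\<Sum>k\<in>I. norm (x k)) / M) powr q) powr (1 / q) \<le> ((1 / M) * K powr q) powr (1 / q)"
    using 2 by (intro powr_mono2) auto
  also have "((1 / M) * K powr q) powr (1 / q) = M powr (- 1 / q) * K"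
    using M K 2 by (simp add: powr_mult powr_powr powr_divide powr_minus_divide)
  finally have "(\<Sum>k\<in>I. norm (x k)) / M \<le> M powr (- 1 / q) * K"
    using M 2 by (simp add: powr_powr sum_nonneg)
  then have "(\<Sum>k\<in>I. norm (x k)) \<le> M powr 1 * M powr (- 1 / q) * K"
    using M by (simp add: field_simps)
  then show ?thesis
    using M 2 powr_add[of M 1 "- 1 / q"] by (simp add: M_def)
qed

lemma norm_le_lp_le: "1 \<le> p \<Longrightarrow> lp_le p K x \<Longrightarrow> norm (x k) \<le> K"
  using lp_le_sum_norm[of p K x "{k}"] by simp

section \<open>Binomial weights\<close>

lemma Bernstein_eq_0: "n < k \<Longrightarrow> Bernstein n k x = 0"
  by (simp add: Bernstein_def)

lemma Bernstein_Suc_0: "Bernstein (Suc n) 0 x = (1 - x) * Bernstein n 0 x"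
  by (simp add: Bernstein_def)

lemma Bernstein_Suc_Suc:
  "Bernstein (Suc n) (Suc k) x = (1 - x) * Bernstein n (Suc k) x + x * Bernstein n k x"
proof (cases "k < n")
  case True
  then have "n - k = Suc (n - Suc k)" by simp
  then show ?thesis by (simp add: Bernstein_def algebra_simps)
qed (auto simp: Bernstein_def not_less le_less binomial_eq_0)

section \<open>Variance and total variation of the weights\<close>

lemma Bernstein_variance:
  "(\<Sum>k\<le>n. Bernstein n k x * (real k - real n * x)\<^sup>2) = real n * x * (1 - x)"
proof -
  have "(\<Sum>k\<le>n. Bernstein n k x * (real k - real n * x)\<^sup>2) =
      (\<Sum>k\<le>n. real k * (real k - 1) * Bernstein n k x
        + (1 - 2 * real n * x) * (real k * Bernstein n k x) + (real n * x)\<^sup>2 * Bernstein n k x)"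
    by (intro sum.cong) (auto simp: power2_eq_square algebra_simps)
  also have "\<dots> = real n * (real n - 1) * x\<^sup>2 + (1 - 2 * real n * x) * (real n * x) + (real n * x)\<^sup>2"
    by (simp only: sum.distrib sum_distrib_left[symmetric] sum_kk_Bernstein sum_k_Bernstein
        sum_Bernstein mult_1_right)
  finally show ?thesis by (simp add: power2_eq_square algebra_simps)
qed

text \<open>Cauchy-Schwarz with each weight split into two square roots: one factor sums to the
  total mass 1, the other to the variance.\<close>

lemma Bernstein_mean_deviation:
  assumes x: "0 \<le> x" "x \<le> 1"
  shows "(\<Sum>k\<le>n. Bernstein n k x * \<bar>real k - real n * x\<bar>) \<le> sqrt (real n * x * (1 - x))"
proof -
  let ?b = "\<lambda>k. Bernstein n k x"
  have b: "0 \<le> ?b k" for k using x by (rule Bernstein_nonneg)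
  have "(\<Sum>k\<le>n. ?b k * \<bar>real k - real n * x\<bar>)
      = (\<Sum>k\<le>n. sqrt (?b k) * (sqrt (?b k) * \<bar>real k - real n * x\<bar>))"
    using b by (intro sum.cong) (auto simp: mult.assoc[symmetric])
  also have "\<dots> \<le> sqrt ((\<Sum>k\<le>n. (sqrt (?b k))\<^sup>2) * (\<Sum>k\<le>n. (sqrt (?b k) * \<bar>real k - real n * x\<bar>)\<^sup>2))"
    by (intro real_le_rsqrt Cauchy_Schwarz_ineq_sum)
  also have "\<dots> = sqrt (real n * x * (1 - x))"
    using b by (simp add: power_mult_distrib Bernstein_variance)
  finally show ?thesis .
qed

text \<open>Both neighbouring weights of order \<open>n\<close> are multiples of the same weight of
  order \<open>Suc n\<close>, by the absorption identities for binomial coefficients. The increment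
  is thus a weight times a centred linear factor, and total variation becomes mean absolute
  deviation. The case split encodes the value 0 at index -1.\<close>

lemma Bernstein_difference:
  assumes x: "0 < x" "x < 1" and k: "k \<le> Suc n"
  shows "(case k of 0 \<Rightarrow> 0 | Suc i \<Rightarrow> Bernstein n i x) - Bernstein n k x
    = Bernstein (Suc n) k x * (real k - real (Suc n) * x) / (real (Suc n) * x * (1 - x))"
proof -
  have a: "real (Suc n) * (1 - x) * Bernstein n k x = (real (Suc n) - real k) * Bernstein (Suc n) k x"
  proof (cases "k \<le> n")
    case True
    then have d: "Suc n - k = Suc (n - k)" by simp
    have "real (Suc n) * real (n choose k) = (real (Suc n) - real k) * real (Suc n choose k)"
      using binomial_absorb_comp[of "Suc n" k] k by (metis diff_Suc_1 of_nat_diff of_nat_mult)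
    then show ?thesis
      by (simp add: Bernstein_def d mult.assoc[symmetric] del: of_nat_Suc binomial_Suc_Suc)
  next
    case False
    then show ?thesis using k by (auto simp: Bernstein_def le_Suc_eq)
  qed
  have c: "real (Suc n) * x * (case k of 0 \<Rightarrow> 0 | Suc i \<Rightarrow> Bernstein n i x)
      = real k * Bernstein (Suc n) k x"
  proof (cases k)
    case (Suc i)
    have "real (Suc n) * real (n choose i) = real (Suc i) * real (Suc n choose Suc i)"
      using Suc_times_binomial_eq[of n i] by (metis mult.commute of_nat_mult)
    then show ?thesis
      by (simp add: Suc Bernstein_def mult.assoc[symmetric] del: of_nat_Suc binomial_Suc_Suc)
  qed simp
  let ?p = "case k of 0 \<Rightarrow> 0 | Suc i \<Rightarrow> Bernstein n i x"
  let ?N = "real (Suc n)" and ?B = "Bernstein (Suc n) k x"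
  have "?N * x * (1 - x) * (?p - Bernstein n k x)
      = (1 - x) * (?N * x * ?p) - x * (?N * (1 - x) * Bernstein n k x)"
    by (simp add: algebra_simps)
  also have "\<dots> = (1 - x) * (real k * ?B) - x * ((?N - real k) * ?B)"
    by (simp only: a c)
  also have "\<dots> = ?B * (real k - ?N * x)"
    by (simp add: algebra_simps)
  finally show ?thesis
    using x by (simp add: field_simps del: of_nat_Suc)
qed

text \<open>Abel summation. No boundary terms appear, since the empty partial sum is 0 and the
  weight at \<open>Suc n\<close> vanishes.\<close>

lemma Bernstein_sum_by_parts:
  fixes w :: "nat \<Rightarrow> 'a::real_vector"
  assumes x: "0 < x" "x < 1"
  shows "(\<Sum>k\<le>n. Bernstein n k x *\<^sub>R w k)
    = (\<Sum>k\<le>Suc n. (Bernstein (Suc n) k x * (real k - real (Suc n) * x) / (real (Suc n) * x * (1 - x)))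
        *\<^sub>R (\<Sum>j<k. w j))"
proof -
  let ?P = "\<lambda>k. \<Sum>j<k. w j" and ?b = "\<lambda>k. Bernstein n k x"
  have "(\<Sum>k\<le>Suc n. (Bernstein (Suc n) k x * (real k - real (Suc n) * x) / (real (Suc n) * x * (1 - x))) *\<^sub>R ?P k)
      = (\<Sum>k\<le>Suc n. ((case k of 0 \<Rightarrow> 0 | Suc i \<Rightarrow> ?b i) - ?b k) *\<^sub>R ?P k)"
    using Bernstein_difference[OF x] by (intro sum.cong) (simp_all del: of_nat_Suc)
  also have "\<dots> = (\<Sum>k\<le>Suc n. (case k of 0 \<Rightarrow> 0 | Suc i \<Rightarrow> ?b i) *\<^sub>R ?P k) - (\<Sum>k\<le>Suc n. ?b k *\<^sub>R ?P k)"
    by (simp only: scaleR_diff_left sum_subtractf)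
  also have "(\<Sum>k\<le>Suc n. (case k of 0 \<Rightarrow> 0 | Suc i \<Rightarrow> ?b i) *\<^sub>R ?P k) = (\<Sum>k\<le>n. ?b k *\<^sub>R ?P (Suc k))"
    by (subst sum.atMost_Suc_shift) simp
  also have "(\<Sum>k\<le>Suc n. ?b k *\<^sub>R ?P k) = (\<Sum>k\<le>n. ?b k *\<^sub>R ?P k)"
    by (simp add: Bernstein_eq_0)
  finally show ?thesis
    by (simp add: sum_subtractf[symmetric] scaleR_diff_right[symmetric])
qed

section \<open>A square root of the shift\<close>

lemma lp_le_nth:
  fixes x :: "int \<Rightarrow> complex^2"
  shows "1 \<le> p \<Longrightarrow> lp_le p K x \<Longrightarrow> lp_le p K (\<lambda>k. x k $ i)"
  using lp_le_scale[of p K x 1 "\<lambda>k. x k $ i"] by (simp add: Finite_Cartesian_Product.norm_nth_le)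

lemma lp_le_vector:
  fixes a b :: "int \<Rightarrow> complex"
  assumes p: "1 \<le> p" and a: "lp_le p K a" and b: "lp_le p L b"
  shows "lp_le p (K + L) (\<lambda>k. vector [a k, b k] :: complex^2)"
proof -
  have 1: "lp_le p K (\<lambda>k. vector [a k, 0] :: complex^2)"
    using lp_le_scale[OF p a, of 1 "\<lambda>k. vector [a k, 0] :: complex^2"]
    by (simp add: norm_vec_def L2_set_def sum_2)
  have 2: "lp_le p L (\<lambda>k. vector [0, b k] :: complex^2)"
    using lp_le_scale[OF p b, of 1 "\<lambda>k. vector [0, b k] :: complex^2"]
    by (simp add: norm_vec_def L2_set_def sum_2)
  have "(\<lambda>k. vector [a k, 0] + vector [0, b k] :: complex^2) = (\<lambda>k. vector [a k, b k])"
    by (simp add: fun_eq_iff vec_eq_iff forall_2)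
  then show ?thesis using lp_le_add[OF p 1 2] by simp
qed

lemma T_op_nth:
  "T_op \<alpha> x k $ 1 = x k $ 1 + x k $ 2 - x (k - 1) $ 2"
  "T_op \<alpha> x k $ 2 = - (of_real \<alpha>)\<^sup>2 * x k $ 1 + (1 - 2 * of_real \<alpha>) * x k $ 2"
  by (simp_all add: T_op_def T0_def T1_def matrix_vector_mult_def sum_2)

definition half_shift :: "real \<Rightarrow> (int \<Rightarrow> complex^2) \<Rightarrow> int \<Rightarrow> complex^2" where
  "half_shift \<alpha> x = (\<lambda>k. vector [x k $ 1 + (x k $ 2 - x (k - 1) $ 2) / of_real \<alpha>,
                               - of_real \<alpha> * x k $ 1 - x k $ 2])"

lemma T_op_half_shift:
  assumes "\<alpha> \<noteq> 0"
  shows "T_op \<alpha> x k = (1 - \<alpha>) *\<^sub>R x k + \<alpha> *\<^sub>R half_shift \<alpha> x k"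
  using assms
  by (simp add: vec_eq_iff forall_2 T_op_nth half_shift_def)
    (simp add: scaleR_conv_of_real field_simps power2_eq_square)

lemma half_shift_half_shift:
  assumes "\<alpha> \<noteq> 0"
  shows "half_shift \<alpha> (half_shift \<alpha> x) = (\<lambda>k. x (k - 1))"
  using assms by (simp add: fun_eq_iff vec_eq_iff forall_2 half_shift_def field_simps)

lemma half_shift_shift: "half_shift \<alpha> (\<lambda>k. x (k - m)) = (\<lambda>k. half_shift \<alpha> x (k - m))"
  by (simp add: half_shift_def fun_eq_iff algebra_simps)

lemma half_shift_add:
  "half_shift \<alpha> (\<lambda>k. x k + y k) k = half_shift \<alpha> x k + half_shift \<alpha> y k"
  by (simp add: half_shift_def vec_eq_iff forall_2 add_divide_distrib diff_divide_distrib algebra_simps)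

lemma half_shift_scaleR:
  "half_shift \<alpha> (\<lambda>k. c *\<^sub>R x k) k = c *\<^sub>R half_shift \<alpha> x k"
  by (simp add: half_shift_def vec_eq_iff forall_2)
    (simp add: scaleR_conv_of_real algebra_simps diff_divide_distrib)

lemma half_shift_sum:
  "half_shift \<alpha> (\<lambda>k. \<Sum>j\<in>A. c j *\<^sub>R w j k) k = (\<Sum>j\<in>A. c j *\<^sub>R half_shift \<alpha> (w j) k)"
proof (induction A rule: infinite_finite_induct)
  case (insert j A)
  then show ?case
    by (simp add: half_shift_add half_shift_scaleR)
qed (simp_all add: half_shift_def vec_eq_iff forall_2)

lemma half_shift_funpow:
  assumes "\<alpha> \<noteq> 0"
  shows "(half_shift \<alpha> ^^ (2 * i)) x = (\<lambda>k. x (k - int i))"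
    and "(half_shift \<alpha> ^^ Suc (2 * i)) x = (\<lambda>k. half_shift \<alpha> x (k - int i))"
proof -
  show e: "(half_shift \<alpha> ^^ (2 * i)) x = (\<lambda>k. x (k - int i))"
    by (induction i) (simp_all add: half_shift_half_shift[OF assms] algebra_simps)
  show "(half_shift \<alpha> ^^ Suc (2 * i)) x = (\<lambda>k. half_shift \<alpha> x (k - int i))"
    by (simp add: e half_shift_shift)
qed

lemma solution_Bernstein:
  assumes "\<alpha> \<noteq> 0"
  shows "solution \<alpha> x n k = (\<Sum>j\<le>n. Bernstein n j \<alpha> *\<^sub>R (half_shift \<alpha> ^^ j) x k)"
proof (induction n arbitrary: k)
  case 0
  then show ?case by (simp add: solution_def Bernstein_def)
next
  case (Suc n)
  let ?w = "\<lambda>j. (half_shift \<alpha> ^^ j) x" and ?b = "\<lambda>j. Bernstein n j \<alpha>"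
  have s: "solution \<alpha> x n = (\<lambda>k. \<Sum>j\<le>n. ?b j *\<^sub>R ?w j k)"
    using Suc by (intro ext)
  have "solution \<alpha> x (Suc n) k = T_op \<alpha> (solution \<alpha> x n) k"
    by (simp add: solution_def)
  also have "\<dots> = (1 - \<alpha>) *\<^sub>R (\<Sum>j\<le>n. ?b j *\<^sub>R ?w j k) + \<alpha> *\<^sub>R (\<Sum>j\<le>n. ?b j *\<^sub>R ?w (Suc j) k)"
    unfolding T_op_half_shift[OF assms] s half_shift_sum by simp
  \<comment> \<open>The added term \<open>j = Suc n\<close> has weight 0; with it the sum can be
    split at \<open>j = 0\<close> and aligned with the second sum for the Pascal rule.\<close>
  also have "(\<Sum>j\<le>n. ?b j *\<^sub>R ?w j k) = (\<Sum>j\<le>Suc n. ?b j *\<^sub>R ?w j k)"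
    by (simp add: Bernstein_eq_0)
  also have "\<dots> = ?b 0 *\<^sub>R ?w 0 k + (\<Sum>j\<le>n. ?b (Suc j) *\<^sub>R ?w (Suc j) k)"
    by (subst sum.atMost_Suc_shift) simp
  also have "(1 - \<alpha>) *\<^sub>R \<dots> + \<alpha> *\<^sub>R (\<Sum>j\<le>n. ?b j *\<^sub>R ?w (Suc j) k)
      = Bernstein (Suc n) 0 \<alpha> *\<^sub>R ?w 0 k + (\<Sum>j\<le>n. Bernstein (Suc n) (Suc j) \<alpha> *\<^sub>R ?w (Suc j) k)"
    by (simp only: Bernstein_Suc_0 Bernstein_Suc_Suc scaleR_add_right scaleR_add_left
        scaleR_sum_right scaleR_scaleR sum.distrib add.assoc)
  also have "\<dots> = (\<Sum>j\<le>Suc n. Bernstein (Suc n) j \<alpha> *\<^sub>R ?w j k)"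
    by (subst sum.atMost_Suc_shift) simp
  finally show ?case .
qed

text \<open>Consecutive powers pair up into \<open>x + half_shift \<alpha> x\<close>, shifted by
  \<open>i\<close>. The second component of \<open>x\<close> cancels in the lower entry and
  telescopes in the upper one.\<close>

lemma half_shift_sum_even:
  assumes "\<alpha> \<noteq> 0"
  shows "(\<Sum>j<2 * m. (half_shift \<alpha> ^^ j) x k) =
    vector [2 * (\<Sum>i<m. x (k - int i) $ 1) + (x k $ 2 - x (k - int m) $ 2) / of_real \<alpha>,
            - of_real \<alpha> * (\<Sum>i<m. x (k - int i) $ 1)]"
proof (induction m)
  case 0
  then show ?case by (simp add: vec_eq_iff forall_2)
next
  case (Suc m)
  have k: "k - int m - 1 = k - (1 + int m)" by simp
  have s: "(\<Sum>j<2 * Suc m. (half_shift \<alpha> ^^ j) x k)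
     = (\<Sum>j<2 * m. (half_shift \<alpha> ^^ j) x k) + x (k - int m) + half_shift \<alpha> x (k - int m)"
    using half_shift_funpow[OF assms, of m x] by (simp del: funpow.simps)
  show ?case unfolding s Suc.IH using assms
    by (simp add: vec_eq_iff forall_2 half_shift_def field_simps k)
qed

section \<open>Bounds for the evolution\<close>

lemma lp_le_half_shift_sum:
  assumes "0 < \<alpha>" and p: "1 \<le> p" and x: "lp_le p L x"
    and K: "\<And>m. lp_le p K (\<lambda>k. \<Sum>i<m. x (k - int i) $ 1)"
  shows "lp_le p ((2 + \<alpha>) * K + (1 + 2 / \<alpha>) * L) (\<lambda>k. \<Sum>j<m. (half_shift \<alpha> ^^ j) x k)"
proof -
  have nz: "\<alpha> \<noteq> 0" using assms by simp
  have even: "lp_le p ((2 + \<alpha>) * K + 2 / \<alpha> * L) (\<lambda>k. \<Sum>j<2 * m. (half_shift \<alpha> ^^ j) x k)" for m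
  proof -
    have a: "lp_le p (norm (2::complex) * K) (\<lambda>k. 2 * (\<Sum>i<m. x (k - int i) $ 1))"
      by (intro lp_le_mult p K)
    have x2: "lp_le p L (\<lambda>k. x k $ 2)" "lp_le p L (\<lambda>k. x (k - int m) $ 2)"
      by (intro lp_le_nth p x lp_le_shift)+
    have b: "lp_le p (norm (1 / of_real \<alpha> :: complex) * (L + L))
        (\<lambda>k. 1 / of_real \<alpha> * (x k $ 2 - x (k - int m) $ 2))"
      by (intro lp_le_mult lp_le_diff p x2)
    have c: "lp_le p (norm (- of_real \<alpha> :: complex) * K) (\<lambda>k. - of_real \<alpha> * (\<Sum>i<m. x (k - int i) $ 1))"
      by (intro lp_le_mult p K)
    have "norm (2::complex) * K + norm (1 / of_real \<alpha> :: complex) * (L + L)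
        + norm (- of_real \<alpha> :: complex) * K = (2 + \<alpha>) * K + 2 / \<alpha> * L"
      using assms(1) by (simp add: norm_divide algebra_simps)
    then show ?thesis
      using lp_le_vector[OF p lp_le_add[OF p a b] c]
      by (simp add: half_shift_sum_even[OF nz])
  qed
  consider i where "m = 2 * i" | i where "m = Suc (2 * i)"
    by (metis even_two_times_div_two odd_two_times_div_two_succ Suc_eq_plus1)
  then show ?thesis
  proof cases
    case 1
    show ?thesis unfolding 1
      by (rule lp_le_mono[OF even]) (use lp_le_nonneg[OF x] in \<open>simp add: algebra_simps\<close>)
  next
    \<comment> \<open>An odd number of terms leaves over one even power, which is a shift of
      \<open>x\<close> and costs one more \<open>L\<close>.\<close>
    case 2
    have "lp_le p ((2 + \<alpha>) * K + 2 / \<alpha> * L + L)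
        (\<lambda>k. (\<Sum>j<2 * i. (half_shift \<alpha> ^^ j) x k) + x (k - int i))"
      by (intro lp_le_add p even lp_le_shift x)
    then show ?thesis
      unfolding 2 by (simp add: half_shift_funpow(1)[OF nz]) (simp add: algebra_simps)
  qed
qed

text \<open>After summation by parts the coefficients are centred deviations divided by the variance
  \<open>D\<close> of order \<open>Suc n\<close>. Their absolute sum is at most
  \<open>sqrt D / D\<close>, the source of the decay.\<close>

lemma lp_le_solution_bounded_sums:
  assumes \<alpha>: "0 < \<alpha>" "\<alpha> < 1" and p: "1 \<le> p"
    and K: "\<And>m. lp_le p K (\<lambda>k. \<Sum>j<m. (half_shift \<alpha> ^^ j) x k)"
  shows "lp_le p (K / sqrt (real (Suc n) * \<alpha> * (1 - \<alpha>))) (solution \<alpha> x n)"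
proof -
  define D where "D = real (Suc n) * \<alpha> * (1 - \<alpha>)"
  define c where "c = (\<lambda>k. Bernstein (Suc n) k \<alpha> * (real k - real (Suc n) * \<alpha>) / D)"
  have D: "0 < D" using \<alpha> by (simp add: D_def)
  have K0: "0 \<le> K" using lp_le_nonneg[OF K] .
  have sol: "solution \<alpha> x n = (\<lambda>l. \<Sum>k\<le>Suc n. c k *\<^sub>R (\<Sum>j<k. (half_shift \<alpha> ^^ j) x l))"
    unfolding c_def D_def using \<alpha>
    by (intro ext) (subst Bernstein_sum_by_parts[symmetric], simp_all add: solution_Bernstein)
  have "(\<Sum>k\<le>Suc n. \<bar>c k\<bar> * K)
      = K / D * (\<Sum>k\<le>Suc n. Bernstein (Suc n) k \<alpha> * \<bar>real k - real (Suc n) * \<alpha>\<bar>)"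
    unfolding sum_distrib_left using D \<alpha> Bernstein_nonneg[of \<alpha> "Suc n"]
    by (intro sum.cong) (simp_all add: c_def abs_mult del: of_nat_Suc)
  also have "\<dots> \<le> K / D * sqrt D"
    using Bernstein_mean_deviation[of \<alpha> "Suc n"] \<alpha> D K0
    by (intro mult_left_mono) (simp_all add: D_def del: of_nat_Suc)
  also have "\<dots> = K / sqrt D"
    using D by (simp add: real_div_sqrt field_simps)
  finally have le: "(\<Sum>k\<le>Suc n. \<bar>c k\<bar> * K) \<le> K / sqrt D" .
  show ?thesis
    unfolding D_def[symmetric] sol
    by (intro lp_le_mono[OF lp_le_sum le] lp_le_scaleR p K)
qed

text \<open>Power boundedness of T. Every power of \<open>half_shift\<close> applied to
  \<open>x\<close> is a shift of \<open>x\<close> or of \<open>half_shift \<alpha> x\<close>, and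
  the weights are nonnegative with sum 1. The constant is the sum of the entrywise bounds in
  \<open>half_shift\<close>.\<close>

lemma lp_le_solution:
  assumes \<alpha>: "0 < \<alpha>" "\<alpha> < 1" and p: "1 \<le> p" and x: "lp_le p K x"
  shows "lp_le p ((2 + \<alpha> + 2 / \<alpha>) * K) (solution \<alpha> x n)"
proof -
  let ?C = "2 + \<alpha> + 2 / \<alpha>"
  have nz: "\<alpha> \<noteq> 0" and K: "0 \<le> K" using \<alpha> lp_le_nonneg[OF x] by auto
  have x1: "lp_le p K (\<lambda>k. x k $ 1)" and x2: "lp_le p K (\<lambda>k. x k $ 2)" "lp_le p K (\<lambda>k. x (k - 1) $ 2)"
    by (intro lp_le_nth p x lp_le_shift)+
  have h: "lp_le p (?C * K) (half_shift \<alpha> x)"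
  proof -
    have "lp_le p ((K + norm (1 / of_real \<alpha> :: complex) * (K + K)) + (norm (- of_real \<alpha> :: complex) * K + K))
      (\<lambda>k. vector [x k $ 1 + 1 / of_real \<alpha> * (x k $ 2 - x (k - 1) $ 2), - of_real \<alpha> * x k $ 1 - x k $ 2] :: complex^2)"
      by (intro lp_le_vector lp_le_add lp_le_diff lp_le_mult p x1 x2)
    then show ?thesis
      using \<alpha> by (simp add: half_shift_def norm_divide diff_divide_distrib algebra_simps)
  qed
  have x': "lp_le p (?C * K) x"
    using mult_right_mono[of 1 ?C K] \<alpha> K by (intro lp_le_mono[OF x]) simp
  have w: "lp_le p (?C * K) ((half_shift \<alpha> ^^ j) x)" for j
  proof (cases "even j")
    case True
    then obtain i where "j = 2 * i" by blast
    then show ?thesis using lp_le_shift[OF p x'] by (simp add: half_shift_funpow(1)[OF nz])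
  next
    case False
    then obtain i where "j = Suc (2 * i)" by (metis oddE Suc_eq_plus1)
    then show ?thesis using lp_le_shift[OF p h] by (simp add: half_shift_funpow(2)[OF nz] del: funpow.simps)
  qed
  have "(\<Sum>j\<le>n. \<bar>Bernstein n j \<alpha>\<bar> * (?C * K)) = ?C * K"
    using \<alpha> by (simp add: sum_distrib_right[symmetric] abs_of_nonneg[OF Bernstein_nonneg])
  moreover have "solution \<alpha> x n = (\<lambda>k. \<Sum>j\<le>n. Bernstein n j \<alpha> *\<^sub>R (half_shift \<alpha> ^^ j) x k)"
    by (intro ext solution_Bernstein nz)
  moreover have "lp_le p (\<Sum>j\<le>n. \<bar>Bernstein n j \<alpha>\<bar> * (?C * K))
      (\<lambda>k. \<Sum>j\<le>n. Bernstein n j \<alpha> *\<^sub>R (half_shift \<alpha> ^^ j) x k)"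
    by (intro lp_le_sum lp_le_scaleR p w)
  ultimately show ?thesis by simp
qed

section \<open>Convergence and rates\<close>

lemma right_shift_funpow: "(right_shift ^^ j) y = (\<lambda>k. y (k - int j))"
  by (induction j) (simp_all add: right_shift_def fun_eq_iff algebra_simps)

lemma shift_mean_eq: "shift_mean y n k = (1 / of_nat n) * (\<Sum>j=1..n. y (k - int j))"
  by (simp add: shift_mean_def right_shift_funpow)

lemma shift_mean_diff: "shift_mean (\<lambda>k. x k - y k) n k = shift_mean x n k - shift_mean y n k"
  by (simp add: shift_mean_eq sum_subtractf right_diff_distrib)

lemma shift_mean_const: "0 < n \<Longrightarrow> shift_mean (\<lambda>_. c) n k = c"
  by (simp add: shift_mean_eq)

text \<open>The means start at lag 1 and the partial sums at lag 0, hence the evaluation one place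
  to the right. It is written as \<open>k - (- 1)\<close> to match
  \<open>lp_le_shift\<close>.\<close>

lemma sum_shift_eq_shift_mean:
  "(\<Sum>i<m. u (k - int i)) = of_nat m * shift_mean u m (k - (- 1))"
proof -
  have "(\<Sum>j=1..m. u (k + 1 - int j)) = (\<Sum>i<m. u (k - int i))"
    by (rule sum.reindex_bij_witness[of _ Suc "\<lambda>j. j - 1"]) (auto simp: algebra_simps of_nat_diff)
  then show ?thesis by (cases "m = 0") (simp_all add: shift_mean_eq)
qed

lemma shift_mean_diff_shift:
  "shift_mean (\<lambda>k. W k - W (k - 1)) n k = (1 / of_nat n) * (W (k - 1) - W (k - (int n + 1)))"
proof -
  have "(\<Sum>j=1..n. W (k - int j) - W (k - int j - 1)) = W (k - 1) - W (k - (int n + 1))"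
    by (induction n) (simp_all add: algebra_simps)
  then show ?thesis by (simp add: shift_mean_eq)
qed

lemma lp_le_sum_shift:
  assumes p: "1 \<le> p" and u: "lp_le p L u"
  shows "lp_le p (real m * L) (\<lambda>k. \<Sum>i<m. u (k - int i))"
  using lp_le_sum[OF p lp_le_shift[OF p u], of "{..<m}" int] by simp

lemma lp_le_shift_mean:
  assumes p: "1 \<le> p" and u: "lp_le p L u"
  shows "lp_le p L (shift_mean u n)"
proof -
  have "lp_le p (norm (1 / of_nat n :: complex) * (\<Sum>j=1..n. L))
      (\<lambda>k. (1 / of_nat n) * (\<Sum>j=1..n. u (k - int j)))"
    by (intro lp_le_mult lp_le_sum lp_le_shift p u)
  moreover have "norm (1 / of_nat n :: complex) * (\<Sum>j=1..n. L) \<le> L"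
    using lp_le_nonneg[OF u] by (simp add: norm_divide)
  ultimately show ?thesis
    unfolding shift_mean_eq[abs_def] by (rule lp_le_mono)
qed

lemma lp_le_shift_mean_coboundary:
  assumes p: "1 \<le> p" and W: "lp_le p L W"
  shows "lp_le p (2 * L / real n) (shift_mean (\<lambda>k. W k - W (k - 1)) n)"
proof -
  have "lp_le p (norm (1 / of_nat n :: complex) * (L + L))
      (\<lambda>k. (1 / of_nat n) * (W (k - 1) - W (k - (int n + 1))))"
    by (intro lp_le_mult lp_le_diff lp_le_shift p W)
  then show ?thesis
    by (simp add: shift_mean_diff_shift[abs_def] norm_divide)
qed

section \<open>Linearity and fixed points of the evolution\<close>

lemma T_op_diff: "T_op \<alpha> (\<lambda>k. x k - y k) = (\<lambda>k. T_op \<alpha> x k - T_op \<alpha> y k)"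
  by (simp add: fun_eq_iff vec_eq_iff forall_2 T_op_nth algebra_simps)

lemma solution_diff:
  "solution \<alpha> (\<lambda>k. x k - y k) n = (\<lambda>k. solution \<alpha> x n k - solution \<alpha> y n k)"
  unfolding solution_def by (induction n) (simp_all add: T_op_diff)

lemma solution_Suc: "solution \<alpha> x (Suc n) = solution \<alpha> (T_op \<alpha> x) n"
  by (simp add: solution_def funpow_swap1)

lemma T_op_limit_state: "T_op \<alpha> (limit_state \<alpha> c) = limit_state \<alpha> c"
  by (simp add: fun_eq_iff vec_eq_iff forall_2 T_op_nth limit_state_def power2_eq_square algebra_simps)

lemma solution_fixed_point: "T_op \<alpha> w = w \<Longrightarrow> solution \<alpha> w n = w"
  by (induction n) (simp_all add: solution_Suc, simp add: solution_def)

text \<open>The first row of the fixed point equation makes the second component shift invariant;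
  the second row ties it to the first component by the factor \<open>- \<alpha> / 2\<close>.\<close>

lemma T_op_fixed_point_cases:
  assumes "0 < \<alpha>" and w: "T_op \<alpha> w = w"
  obtains c where "w = limit_state \<alpha> c"
proof -
  have 2: "w k $ 2 = w (k - 1) $ 2" for k
    using T_op_nth(1)[of \<alpha> w k] unfolding w by (simp add: algebra_simps)
  have 1: "w k $ 2 = - of_real \<alpha> * w k $ 1 / 2" for k
  proof -
    have "2 * of_real \<alpha> * w k $ 2 = 2 * of_real \<alpha> * (- of_real \<alpha> * w k $ 1 / 2)"
      using T_op_nth(2)[of \<alpha> w k] unfolding w
      by (simp add: power2_eq_square algebra_simps eq_neg_iff_add_eq_0)
    then show ?thesis unfolding mult_cancel_left using assms(1) by simp
  qed
  have "w k $ 2 = w 0 $ 2" for k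
  proof (induction k rule: int_induct[where k = 0])
    case (step1 i)
    then show ?case using 2[of "i + 1"] by simp
  next
    case (step2 i)
    then show ?case using 2[of i] by simp
  qed simp
  then have "w k $ 1 = w 0 $ 1" for k
    using 1[of k] 1[of 0] assms(1) by auto
  then have "w = limit_state \<alpha> (w 0 $ 1)"
    using 1 by (simp add: fun_eq_iff vec_eq_iff forall_2 limit_state_def)
  then show ?thesis by (rule that)
qed

lemma limit_state_in_lp:
  assumes p: "1 \<le> p" and c: "(\<lambda>_. c) \<in> lp p"
  shows "limit_state \<alpha> c \<in> lp p"
proof -
  have c': "lp_le p (lp_norm p (\<lambda>_. c)) (\<lambda>_. c)" using c by (rule lp_le_lp_norm)
  have "lp_le p (lp_norm p (\<lambda>_. c) + norm (- of_real \<alpha> / 2 :: complex) * lp_norm p (\<lambda>_. c))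
      (\<lambda>k. vector [c, (- of_real \<alpha> / 2) * c] :: complex^2)"
    by (intro lp_le_vector lp_le_mult p c')
  then show ?thesis by (simp add: limit_state_def lp_le_def)
qed

section \<open>Decay from bounded partial sums\<close>

text \<open>The common engine of (a), (b) and (c): each of them only has to exhibit bounded partial
  sums of a first component.\<close>

lemma solution_decay:
  assumes \<alpha>: "0 < \<alpha>" "\<alpha> < 1" and p: "1 \<le> p" and x: "x \<in> lp p"
    and K: "\<And>m. lp_le p K (\<lambda>k. \<Sum>i<m. x (k - int i) $ 1)"
  obtains C where "\<And>n. lp_le p (C / sqrt (real (Suc n))) (solution \<alpha> x n)"
proof -
  define B where "B = (2 + \<alpha>) * K + (1 + 2 / \<alpha>) * lp_norm p x"
  have "lp_le p (B / sqrt (real (Suc n) * \<alpha> * (1 - \<alpha>))) (solution \<alpha> x n)" for n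
    unfolding B_def
    by (intro lp_le_solution_bounded_sums lp_le_half_shift_sum \<alpha> p K lp_le_lp_norm x)
  then show ?thesis
    by (intro that[of "B / sqrt (\<alpha> * (1 - \<alpha>))"]) (simp add: real_sqrt_mult mult_ac del: of_nat_Suc)
qed

lemma lp_norm_bigo_inverse_sqrt:
  assumes "\<And>n. lp_le p (C / sqrt (real (Suc n))) (f n)"
  shows "(\<lambda>n. lp_norm p (f n)) \<in> O(\<lambda>n. real n powr (-1/2))"
proof (rule bigoI[of _ C])
  have "norm (lp_norm p (f n)) \<le> C * norm (real n powr (-1/2))" if n: "1 \<le> n" for n
  proof -
    have C: "0 \<le> C" using lp_le_nonneg[OF assms[of 0]] by simp
    have "lp_norm p (f n) \<le> C / sqrt (real (Suc n))" "0 \<le> lp_norm p (f n)"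
      using assms[of n] lp_norm_nonneg by (auto simp: lp_le_def)
    moreover have "C / sqrt (real (Suc n)) \<le> C / sqrt (real n)"
      using C n by (intro divide_left_mono) auto
    moreover have "real n powr (-1/2) = 1 / sqrt (real n)"
      using n by (simp add: powr_minus_divide powr_half_sqrt)
    ultimately show ?thesis by simp
  qed
  then show "\<forall>\<^sub>F n in sequentially. norm (lp_norm p (f n)) \<le> C * norm (real n powr (-1/2))"
    by (auto simp: eventually_sequentially)
qed

text \<open>The increments form the solution started at \<open>T x - x\<close>, whose first
  component is the difference of neighbouring velocities. Its partial sums telescope, whatever
  \<open>x\<close> is.\<close>

lemma solution_increment_bigo:
  assumes \<alpha>: "0 < \<alpha>" "\<alpha> < 1" and p: "1 \<le> p" and x: "x \<in> lp p"
  shows "(\<lambda>n. lp_norm p (\<lambda>k. solution \<alpha> x (n + 1) k - solution \<alpha> x n k)) \<in> O(\<lambda>n. real n powr (-1/2))"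
proof -
  define v where "v = (\<lambda>k. x k $ 2)"
  define d where "d = (\<lambda>k. T_op \<alpha> x k - x k)"
  have d: "d \<in> lp p"
    unfolding d_def using T_op_bounded[OF p] x by (blast intro: lp_diff p)
  have v: "lp_le p (lp_norm p x) v"
    unfolding v_def by (intro lp_le_nth lp_le_lp_norm p x)
  have d1: "(\<Sum>i<m. d (k - int i) $ 1) = v k - v (k - int m)" for m k
    by (induction m) (simp_all add: d_def v_def T_op_nth algebra_simps)
  have "lp_le p (lp_norm p x + lp_norm p x) (\<lambda>k. \<Sum>i<m. d (k - int i) $ 1)" for m
    unfolding d1 by (intro lp_le_diff lp_le_shift p v)
  then obtain C where "\<And>n. lp_le p (C / sqrt (real (Suc n))) (solution \<alpha> d n)"
    using solution_decay[OF \<alpha> p d] by blast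
  moreover have "solution \<alpha> d n = (\<lambda>k. solution \<alpha> x (n + 1) k - solution \<alpha> x n k)" for n
    by (simp add: d_def solution_diff solution_Suc)
  ultimately show ?thesis
    using lp_norm_bigo_inverse_sqrt[of p C "solution \<alpha> d"] by simp
qed

lemma solution_rate:
  assumes \<alpha>: "0 < \<alpha>" "\<alpha> < 1" and p: "1 \<le> p" and x: "x \<in> lp p" and c: "(\<lambda>_. c) \<in> lp p"
    and O: "(\<lambda>n. lp_norm p (\<lambda>k. shift_mean (first_component x) n k - c)) \<in> O(\<lambda>n. 1 / real n)"
  shows "(\<lambda>n. lp_norm p (\<lambda>k. solution \<alpha> x n k - limit_state \<alpha> c k)) \<in> O(\<lambda>n. real n powr (-1/2))"
proof -
  define d where "d = (\<lambda>k. x k - limit_state \<alpha> c k)"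
  define u where "u = (\<lambda>k. d k $ 1)"
  have d: "d \<in> lp p"
    unfolding d_def by (intro lp_diff p x limit_state_in_lp c)
  have u: "lp_le p (lp_norm p d) u"
    unfolding u_def by (intro lp_le_nth lp_le_lp_norm p d)
  have ueq: "u = (\<lambda>k. first_component x k - c)"
    by (simp add: u_def d_def first_component_def limit_state_def)
  obtain C where "C > 0" and
    C: "\<forall>\<^sub>F n in sequentially. norm (lp_norm p (\<lambda>k. shift_mean (first_component x) n k - c)) \<le> C * norm (1 / real n)"
    using O by (elim landau_o.bigE)
  then obtain N where N: "\<And>n. N \<le> n \<Longrightarrow>
      norm (lp_norm p (\<lambda>k. shift_mean (first_component x) n k - c)) \<le> C * norm (1 / real n)"
    by (auto simp: eventually_sequentially)
  \<comment> \<open>The hypothesis controls only large \<open>m\<close>; for the finitely many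
    others the trivial bound by the number of terms is enough.\<close>
  define K where "K = max C (real (Suc N) * lp_norm p d)"
  have "lp_le p K (\<lambda>k. \<Sum>i<m. d (k - int i) $ 1)" for m
  proof (cases "m \<le> Suc N")
    case True
    have "lp_le p (real m * lp_norm p d) (\<lambda>k. \<Sum>i<m. u (k - int i))"
      by (intro lp_le_sum_shift p u)
    moreover have "real m * lp_norm p d \<le> K"
      unfolding K_def using True lp_norm_nonneg[OF d]
      by (intro max.coboundedI2 mult_right_mono) auto
    ultimately show ?thesis unfolding u_def by (rule lp_le_mono)
  next
    case False
    then have m: "0 < m" "N \<le> m" by auto
    have sm: "shift_mean u m = (\<lambda>k. shift_mean (first_component x) m k - c)"
      using m by (simp add: ueq shift_mean_diff shift_mean_const fun_eq_iff)
    have "shift_mean u m \<in> lp p"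
      using u by (intro lp_shift_mean p) (simp add: lp_le_def)
    then have "lp_le p (C / real m) (shift_mean u m)"
      using N[OF m(2)] by (simp add: lp_le_def sm)
    then have "lp_le p (norm (of_nat m :: complex) * (C / real m)) (\<lambda>k. of_nat m * shift_mean u m (k - (- 1)))"
      by (intro lp_le_mult lp_le_shift p)
    then have "lp_le p C (\<lambda>k. \<Sum>i<m. u (k - int i))"
      using m by (simp add: sum_shift_eq_shift_mean)
    then show ?thesis unfolding u_def K_def by (rule lp_le_mono) simp
  qed
  then obtain C' where "\<And>n. lp_le p (C' / sqrt (real (Suc n))) (solution \<alpha> d n)"
    using solution_decay[OF \<alpha> p d] by blast
  moreover have "solution \<alpha> d n = (\<lambda>k. solution \<alpha> x n k - limit_state \<alpha> c k)" for n
    by (simp add: d_def solution_diff solution_fixed_point T_op_limit_state)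
  ultimately show ?thesis
    using lp_norm_bigo_inverse_sqrt[of p C' "solution \<alpha> d"] by simp
qed

text \<open>Length and lag trade places, since both splittings \<open>m + j\<close> and
  \<open>j + m\<close> give the same total. A difference of long sums at a short lag becomes a
  difference of short sums.\<close>

lemma sum_minus_shifted_sum:
  fixes f :: "nat \<Rightarrow> 'a::ab_group_add"
  shows "(\<Sum>i<m. f i) - (\<Sum>i<m. f (i + j)) = (\<Sum>i<j. f i) - (\<Sum>i<j. f (i + m))"
proof -
  have "(\<Sum>i<a. f i) + (\<Sum>i<b. f (i + a)) = (\<Sum>i<a + b. f i)" for a b
    by (induction b) (simp_all add: algebra_simps)
  from this[of m j] this[of j m] show ?thesis
    by (simp add: algebra_simps)
qed

text \<open>The sequence minus its mean is the average over \<open>j\<close> of \<open>u\<close>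
  minus its shift by \<open>j\<close>. Each such difference has partial sums consisting of
  \<open>2 * j\<close> shifted copies of \<open>u\<close>, independently of
  \<open>m\<close>.\<close>

lemma lp_le_sum_minus_shift_mean:
  assumes p: "1 \<le> p" and u: "lp_le p L u" and N: "0 < N"
  shows "lp_le p (2 * real N * L) (\<lambda>k. \<Sum>i<m. u (k - int i) - shift_mean u N (k - int i))"
proof -
  have L: "0 \<le> L" using lp_le_nonneg[OF u] .
  have eq: "(\<Sum>i<m. u (k - int i) - shift_mean u N (k - int i)) =
    (1 / of_nat N) * (\<Sum>j=1..N. (\<Sum>i<j. u (k - int i)) - (\<Sum>i<j. u (k - int m - int i)))" for k
  proof -
    have "(\<Sum>i<m. u (k - int i)) - (\<Sum>i<m. shift_mean u N (k - int i))
        = (1 / of_nat N) * (\<Sum>j=1..N. \<Sum>i<m. u (k - int i))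
          - (1 / of_nat N) * (\<Sum>j=1..N. \<Sum>i<m. u (k - int i - int j))"
      using N by (simp add: shift_mean_eq sum_distrib_left sum.swap[of _ "{..<m}"])
    also have "\<dots> = (1 / of_nat N) * (\<Sum>j=1..N. (\<Sum>i<m. u (k - int i)) - (\<Sum>i<m. u (k - int (i + j))))"
      by (simp only: right_diff_distrib[symmetric] sum_subtractf) (simp add: algebra_simps)
    also have "\<dots> = (1 / of_nat N) * (\<Sum>j=1..N. (\<Sum>i<j. u (k - int i)) - (\<Sum>i<j. u (k - int (i + m))))"
      using sum_minus_shifted_sum[of "\<lambda>i. u (k - int i)" m] by simp
    finally show ?thesis
      by (simp add: sum_subtractf algebra_simps)
  qed
  have j: "lp_le p (2 * real N * L) (\<lambda>k. (\<Sum>i<j. u (k - int i)) - (\<Sum>i<j. u (k - int m - int i)))"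
    if "j \<in> {1..N}" for j
  proof -
    have s: "lp_le p (real N * L) (\<lambda>k. \<Sum>i<j. u (k - int i))"
      by (rule lp_le_mono[OF lp_le_sum_shift[OF p u]]) (use that L in \<open>simp add: mult_right_mono\<close>)
    have "lp_le p (real N * L + real N * L) (\<lambda>k. (\<Sum>i<j. u (k - int i)) - (\<Sum>i<j. u (k - int m - int i)))"
      by (intro lp_le_diff p s lp_le_shift[OF p s])
    then show ?thesis by (simp add: algebra_simps)
  qed
  have "lp_le p (norm (1 / of_nat N :: complex) * (\<Sum>j=1..N. 2 * real N * L))
     (\<lambda>k. (1 / of_nat N) * (\<Sum>j=1..N. (\<Sum>i<j. u (k - int i)) - (\<Sum>i<j. u (k - int m - int i))))"
    by (intro lp_le_mult lp_le_sum p j)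
  then show ?thesis
    unfolding eq using N by (simp add: norm_divide)
qed

lemma solution_tendsto_zero:
  assumes \<alpha>: "0 < \<alpha>" "\<alpha> < 1" and p: "1 \<le> p" and x: "x \<in> lp p"
    and lim: "(\<lambda>n. lp_norm p (shift_mean (first_component x) n)) \<longlonglongrightarrow> 0"
  shows "(\<lambda>n. lp_norm p (solution \<alpha> x n)) \<longlonglongrightarrow> 0"
proof (rule LIMSEQ_I)
  fix e :: real
  assume e: "0 < e"
  define u where "u = first_component x"
  define B where "B = 2 + \<alpha> + 2 / \<alpha>"
  have B: "0 < B" using \<alpha> by (simp add: B_def add_pos_pos)
  have u: "u \<in> lp p" unfolding u_def by (rule lp_first_component[OF p x])
  obtain N0 where "\<And>n. n \<ge> N0 \<Longrightarrow> lp_norm p (shift_mean u n) < e / (2 * B)"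
    using order_tendstoD(2)[OF lim, of "e / (2 * B)"] e B
    by (auto simp: eventually_sequentially u_def)
  then obtain N where N: "0 < N" "lp_norm p (shift_mean u N) < e / (2 * B)"
    by (metis le_add1 zero_less_Suc Suc_n_not_le_n add_gr_0 less_Suc_eq_le not_less plus_1_eq_Suc)
  \<comment> \<open>The part \<open>b\<close> carries the small mean: by power boundedness with
    constant \<open>B\<close> it stays below \<open>e / 2\<close> for all times. The remainder
    \<open>a\<close> has bounded partial sums and decays.\<close>
  define b where "b = (\<lambda>k. vector [shift_mean u N k, 0] :: complex^2)"
  define a where "a = (\<lambda>k. x k - b k)"
  have "lp_le p (e / (2 * B)) (shift_mean u N)"
    using N lp_shift_mean[OF p u] by (simp add: lp_le_def)
  then have "lp_le p (e / (2 * B) + 0) b"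
    unfolding b_def by (intro lp_le_vector lp_le_zero p)
  then have b: "lp_le p (e / (2 * B)) b" by simp
  have a: "a \<in> lp p"
    unfolding a_def using b by (intro lp_diff p x) (simp add: lp_le_def)
  have "lp_le p (2 * real N * lp_norm p u) (\<lambda>k. \<Sum>i<m. a (k - int i) $ 1)" for m
    using lp_le_sum_minus_shift_mean[OF p lp_le_lp_norm[OF u] N(1), of m]
    by (simp add: a_def b_def u_def first_component_def)
  then obtain C where C: "\<And>n. lp_le p (C / sqrt (real (Suc n))) (solution \<alpha> a n)"
    using solution_decay[OF \<alpha> p a] by blast
  have "(\<lambda>n. C / sqrt (real (Suc n))) \<longlonglongrightarrow> 0"
    by real_asymp
  then obtain M where M: "\<And>n. n \<ge> M \<Longrightarrow> C / sqrt (real (Suc n)) < e / 2"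
    using order_tendstoD(2)[of _ 0 sequentially "e / 2"] e
    by (force simp: eventually_sequentially)
  have bn: "lp_le p (B * (e / (2 * B))) (solution \<alpha> b n)" for n
    unfolding B_def using lp_le_solution[OF \<alpha> p b] by (simp add: B_def)
  have "norm (lp_norm p (solution \<alpha> x n) - 0) < e" if n: "n \<ge> M" for n
  proof -
    have "lp_le p (C / sqrt (real (Suc n)) + B * (e / (2 * B)))
        (\<lambda>k. solution \<alpha> a n k + solution \<alpha> b n k)"
      by (intro lp_le_add p C bn)
    moreover have "(\<lambda>k. solution \<alpha> a n k + solution \<alpha> b n k) = solution \<alpha> x n"
      by (simp add: a_def solution_diff)
    ultimately have "lp_le p (C / sqrt (real (Suc n)) + e / 2) (solution \<alpha> x n)"
      using B by (simp del: of_nat_Suc)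
    then show ?thesis
      using M[OF n] lp_norm_nonneg[of "solution \<alpha> x n" p] unfolding lp_le_def real_norm_def by linarith
  qed
  then show "\<exists>M. \<forall>n\<ge>M. norm (lp_norm p (solution \<alpha> x n) - 0) < e" by blast
qed

lemma lp_tendsto_solution_limit_state:
  assumes \<alpha>: "0 < \<alpha>" "\<alpha> < 1" and p: "1 \<le> p" and x: "x \<in> lp p"
    and lim: "lp_tendsto p (shift_mean (first_component x)) (\<lambda>_. c)"
  shows "lp_tendsto p (solution \<alpha> x) (limit_state \<alpha> c)"
proof -
  have c: "(\<lambda>_. c) \<in> lp p" using lim by (simp add: lp_tendsto_def)
  define d where "d = (\<lambda>k. x k - limit_state \<alpha> c k)"
  have ls: "limit_state \<alpha> c \<in> lp p" by (rule limit_state_in_lp[OF p c])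
  have d: "d \<in> lp p"
    unfolding d_def by (intro lp_diff p x ls)
  have fd: "first_component d = (\<lambda>k. first_component x k - c)"
    by (simp add: d_def first_component_def limit_state_def)
  \<comment> \<open>At \<open>n = 0\<close> every mean is 0 by division by zero, including that of a
    constant, so the two expressions agree only for positive \<open>n\<close>.\<close>
  have "(\<lambda>n. lp_norm p (shift_mean (first_component d) n)) \<longlonglongrightarrow> 0"
  proof (rule Lim_transform_eventually)
    show "(\<lambda>n. lp_norm p (\<lambda>k. shift_mean (first_component x) n k - c)) \<longlonglongrightarrow> 0"
      using lim by (simp add: lp_tendsto_def)
    show "\<forall>\<^sub>F n in sequentially. lp_norm p (\<lambda>k. shift_mean (first_component x) n k - c)
        = lp_norm p (shift_mean (first_component d) n)"
      using eventually_gt_at_top[of 0]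
      by eventually_elim
        (rule arg_cong[where f = "lp_norm p"], simp add: fd shift_mean_diff shift_mean_const fun_eq_iff)
  qed
  from solution_tendsto_zero[OF \<alpha> p d this] show ?thesis
    using ls by (simp add: lp_tendsto_def d_def solution_diff solution_fixed_point T_op_limit_state)
qed

section \<open>From convergent solutions back to convergent means\<close>

text \<open>Fix a single time \<open>m\<close> at which the solution is small. The first components
  at times \<open>m\<close> and 0 differ by a coboundary of the summed velocities, whose means are
  O(1/n), and averaging does not increase the norm of the small part.\<close>

lemma shift_mean_tendsto_zero:
  assumes p: "1 \<le> p" and x: "x \<in> lp p"
    and lim: "(\<lambda>n. lp_norm p (solution \<alpha> x n)) \<longlonglongrightarrow> 0"
  shows "(\<lambda>n. lp_norm p (shift_mean (first_component x) n)) \<longlonglongrightarrow> 0"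
proof (rule LIMSEQ_I)
  fix e :: real
  assume e: "0 < e"
  obtain m where m: "lp_norm p (solution \<alpha> x m) < e / 2"
    using order_tendstoD(2)[OF lim, of "e / 2"] e by (auto simp: eventually_sequentially)
  define H where "H = (\<lambda>k. \<Sum>i<m. solution \<alpha> x i k $ 2)"
  define L where "L = (\<Sum>i<m. lp_norm p (solution \<alpha> x i))"
  have H: "lp_le p L H"
    unfolding H_def L_def by (intro lp_le_sum lp_le_nth lp_le_lp_norm lp_solution p x)
  have s: "lp_le p (e / 2) (\<lambda>k. solution \<alpha> x m k $ 1)"
    using m by (intro lp_le_nth p) (simp add: lp_le_def lp_solution p x)
  have "solution \<alpha> x m k $ 1 - x k $ 1 = H k - H (k - 1)" for k
    unfolding H_def by (induction m) (simp_all add: solution_def T_op_nth algebra_simps)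
  then have u: "first_component x = (\<lambda>k. solution \<alpha> x m k $ 1 - (H k - H (k - 1)))"
    by (simp add: first_component_def fun_eq_iff) (metis add_diff_cancel_left' add_diff_eq diff_add_cancel)
  have le: "lp_norm p (shift_mean (first_component x) n) \<le> e / 2 + 2 * L / real n" for n
  proof -
    have "lp_le p (e / 2 + 2 * L / real n)
      (\<lambda>k. shift_mean (\<lambda>k. solution \<alpha> x m k $ 1) n k - shift_mean (\<lambda>k. H k - H (k - 1)) n k)"
      by (intro lp_le_diff p lp_le_shift_mean s lp_le_shift_mean_coboundary H)
    then show ?thesis
      unfolding u shift_mean_diff[symmetric] by (simp add: lp_le_def)
  qed
  have "(\<lambda>n. 2 * L / real n) \<longlonglongrightarrow> 0"
    by real_asymp
  then obtain M where M: "\<And>n. n \<ge> M \<Longrightarrow> 2 * L / real n < e / 2"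
    using order_tendstoD(2)[of _ 0 sequentially "e / 2"] e
    by (force simp: eventually_sequentially)
  have "norm (lp_norm p (shift_mean (first_component x) n) - 0) < e" if "n \<ge> M" for n
    using le[of n] M[OF that] lp_norm_nonneg[OF lp_shift_mean[OF p lp_first_component[OF p x]], of n]
    by simp
  then show "\<exists>M. \<forall>n\<ge>M. norm (lp_norm p (shift_mean (first_component x) n) - 0) < e" by blast
qed

lemma lp_tendsto_pointwise:
  assumes p: "1 \<le> p" and u: "\<And>n. u n \<in> lp p" and lim: "lp_tendsto p u w"
  shows "(\<lambda>n. u n k) \<longlonglongrightarrow> w k"
proof (rule LIM_zero_cancel, rule Lim_null_comparison)
  show "\<forall>\<^sub>F n in sequentially. norm (u n k - w k) \<le> lp_norm p (\<lambda>k. u n k - w k)"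
    using lim u
    by (intro always_eventually allI norm_le_lp_le[OF p lp_le_lp_norm, of "\<lambda>k. u _ k - w k" k] lp_diff p)
      (auto simp: lp_tendsto_def)
  show "(\<lambda>n. lp_norm p (\<lambda>k. u n k - w k)) \<longlonglongrightarrow> 0"
    using lim by (simp add: lp_tendsto_def)
qed

text \<open>Entrywise limits suffice, because each entry of \<open>T_op\<close> involves only two
  neighbouring entries.\<close>

lemma solution_limit_fixed_point:
  assumes p: "1 \<le> p" and x: "x \<in> lp p" and lim: "lp_tendsto p (solution \<alpha> x) w"
  shows "T_op \<alpha> w = w"
proof
  fix k
  have l: "(\<lambda>n. solution \<alpha> x n i) \<longlonglongrightarrow> w i" for i
    by (intro lp_tendsto_pointwise[OF p] lp_solution p x lim)
  have "(\<lambda>n. T0 \<alpha> *v solution \<alpha> x n k + T1 *v solution \<alpha> x n (k - 1)) \<longlonglongrightarrow> T0 \<alpha> *v w k + T1 *v w (k - 1)"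
    by (intro tendsto_add tendsto_compose[OF _ l] isCont_tendsto_compose[OF _ l]
        linear_continuous_at linear_conv_bounded_linear[THEN iffD1] matrix_vector_mul_linear)
  moreover have "(\<lambda>n. solution \<alpha> x (Suc n) k) \<longlonglongrightarrow> w k"
    using l by (rule LIMSEQ_Suc)
  ultimately show "T_op \<alpha> w k = w k"
    by (simp add: solution_def T_op_def LIMSEQ_unique)
qed

text \<open>The limit is a fixed point, hence a constant sequence; subtracting it reduces to limit
  0.\<close>

lemma shift_mean_tendsto_of_solution:
  assumes \<alpha>: "0 < \<alpha>" and p: "1 \<le> p" and x: "x \<in> lp p" and lim: "lp_tendsto p (solution \<alpha> x) w"
  obtains c where "lp_tendsto p (shift_mean (first_component x)) (\<lambda>_. c)"
proof -
  have Tw: "T_op \<alpha> w = w" by (rule solution_limit_fixed_point[OF p x lim])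
  obtain c where c: "w = limit_state \<alpha> c" by (rule T_op_fixed_point_cases[OF \<alpha> Tw])
  have w: "w \<in> lp p" using lim by (simp add: lp_tendsto_def)
  define d where "d = (\<lambda>k. x k - w k)"
  have d: "d \<in> lp p" unfolding d_def by (intro lp_diff p x w)
  have fw: "first_component w = (\<lambda>_. c)"
    by (simp add: c first_component_def limit_state_def)
  have fd: "first_component d = (\<lambda>k. first_component x k - c)"
    using fw by (simp add: d_def first_component_def fun_eq_iff)
  have "(\<lambda>n. lp_norm p (solution \<alpha> d n)) \<longlonglongrightarrow> 0"
    using lim by (simp add: lp_tendsto_def d_def solution_diff solution_fixed_point[OF Tw])
  then have "(\<lambda>n. lp_norm p (shift_mean (first_component d) n)) \<longlonglongrightarrow> 0"
    by (rule shift_mean_tendsto_zero[OF p d])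
  then have "(\<lambda>n. lp_norm p (\<lambda>k. shift_mean (first_component x) n k - c)) \<longlonglongrightarrow> 0"
  proof (rule Lim_transform_eventually)
    show "\<forall>\<^sub>F n in sequentially. lp_norm p (shift_mean (first_component d) n)
        = lp_norm p (\<lambda>k. shift_mean (first_component x) n k - c)"
      using eventually_gt_at_top[of 0]
      by eventually_elim
        (rule arg_cong[where f = "lp_norm p"], simp add: fd shift_mean_diff shift_mean_const fun_eq_iff)
  qed
  moreover have "(\<lambda>_. c) \<in> lp p"
    using lp_first_component[OF p w] by (simp add: fw)
  ultimately show ?thesis by (intro that) (simp add: lp_tendsto_def)
qed

section \<open>Cesaro means of the shift\<close>

lemma lp_const_eq_zero:
  assumes p: "1 \<le> p" "p < \<infinity>" and c: "(\<lambda>_. c) \<in> lp p"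
  shows "c = 0"
proof (rule ccontr)
  assume "c \<noteq> 0"
  obtain q where q: "p = ereal q" "1 \<le> q"
    using p by (cases rule: lp_exponent_cases) auto
  define f where "f = (\<lambda>_::int. norm c powr q)"
  have s: "f summable_on UNIV"
    using c by (simp add: lp_def q f_def)
  have pos: "0 < norm c powr q" using \<open>c \<noteq> 0\<close> by simp
  obtain n :: nat where n: "infsum f UNIV / norm c powr q < real n"
    using reals_Archimedean2 by blast
  have "sum f (int ` {..<n}) \<le> infsum f UNIV"
    by (intro finite_sum_le_infsum s) (auto simp: f_def)
  moreover have "sum f (int ` {..<n}) = real n * norm c powr q"
    by (subst sum.reindex) (auto simp: f_def)
  ultimately show False using n pos by (simp add: field_simps)
qed

lemma lp_approx_finite_support:
  fixes y :: "int \<Rightarrow> 'a::real_normed_vector"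
  assumes q: "1 \<le> q" and y: "y \<in> lp (ereal q)" and e: "0 < e"
  obtains F where "finite F" "lp_le (ereal q) e (\<lambda>k. if k \<in> F then 0 else y k)"
proof -
  define f where "f = (\<lambda>k. norm (y k) powr q)"
  have s: "f summable_on UNIV" using y by (simp add: lp_def f_def)
  obtain F where F: "finite F" "dist (sum f F) (infsum f UNIV) \<le> e powr q"
    using infsum_finite_approximation[OF s, of "e powr q"] e by auto
  have "(\<Sum>k\<in>G. norm (if k \<in> F then 0 else y k) powr q) \<le> e powr q" if G: "finite G" for G
  proof -
    have "(\<Sum>k\<in>G. norm (if k \<in> F then 0 else y k) powr q) = sum f (G - F)"
      using G by (intro sum.mono_neutral_cong_right) (auto simp: f_def)
    also have "\<dots> = sum f (F \<union> (G - F)) - sum f F"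
      using F G by (subst sum.union_disjoint) auto
    also have "\<dots> \<le> infsum f UNIV - sum f F"
      using F G by (intro diff_right_mono finite_sum_le_infsum s) (auto simp: f_def)
    also have "\<dots> \<le> e powr q" using F by (simp add: dist_real_def)
    finally show ?thesis .
  qed
  then show ?thesis
    using F(1) q e by (intro that) (auto simp: lp_le_ereal)
qed

text \<open>The mean of a unit mass is \<open>1 / n\<close> on \<open>n\<close> consecutive sites.
  The resulting exponent \<open>1 / q - 1\<close> is negative exactly for
  \<open>q > 1\<close>.\<close>

lemma lp_le_shift_mean_delta:
  assumes q: "1 \<le> q"
  shows "lp_le (ereal q) (real n powr (1 / q - 1)) (shift_mean (\<lambda>k. if k = m then 1 else 0) n)"
proof -
  have val: "norm (shift_mean (\<lambda>k. if k = m then 1 else 0) n k)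
      = (if k \<in> (\<lambda>j. m + int j) ` {1..n} then 1 / real n else 0)" for k
  proof (cases "k \<in> (\<lambda>j. m + int j) ` {1..n}")
    case True
    then obtain i where i: "k = m + int i" "i \<in> {1..n}" by blast
    have "(\<Sum>j=1..n. if k - int j = m then 1 else 0) = (\<Sum>j=1..n. if j = i then 1 else (0::complex))"
      by (intro sum.cong) (auto simp: i)
    then show ?thesis using True i by (simp add: shift_mean_eq norm_divide)
  next
    case False
    then have "(\<Sum>j=1..n. if k - int j = m then 1 else 0) = (0::complex)"
      by (intro sum.neutral) (auto simp: image_iff algebra_simps)
    then show ?thesis using False by (simp add: shift_mean_eq)
  qed
  let ?I = "(\<lambda>j. m + int j) ` {1..n}"
  have "(\<Sum>k\<in>G. norm (shift_mean (\<lambda>k. if k = m then 1 else 0) n k) powr q)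
      \<le> (real n powr (1 / q - 1)) powr q" if G: "finite G" for G
  proof (cases "n = 0")
    case False
    have "(\<Sum>k\<in>G. norm (shift_mean (\<lambda>k. if k = m then 1 else 0) n k) powr q)
        = (\<Sum>k\<in>G \<inter> ?I. (1 / real n) powr q)"
      unfolding val using G by (intro sum.mono_neutral_cong_right) auto
    also have "\<dots> \<le> (\<Sum>k\<in>?I. (1 / real n) powr q)"
      by (intro sum_mono2) auto
    also have "\<dots> = real n * (1 / real n) powr q"
      by (subst sum.reindex) (auto simp: inj_on_def)
    also have "\<dots> = real n powr 1 * real n powr (- q)"
      using False by (simp add: powr_divide powr_minus_divide)
    also have "\<dots> = (real n powr (1 / q - 1)) powr q"
      using q False unfolding powr_powr powr_add[symmetric] by (simp add: algebra_simps)
    finally show ?thesis .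
  next
    case True
    then show ?thesis unfolding val by simp
  qed
  then show ?thesis using q by (simp add: lp_le_ereal)
qed

text \<open>A density argument: finitely many unit masses have decaying means, and the means of the
  small tail are no larger than the tail.\<close>

lemma shift_mean_tendsto_zero_reflexive:
  assumes p: "1 < p" "p < \<infinity>" and y: "y \<in> lp p"
  shows "(\<lambda>n. lp_norm p (shift_mean y n)) \<longlonglongrightarrow> 0"
proof (rule LIMSEQ_I)
  fix e :: real
  assume e: "0 < e"
  have p1: "1 \<le> p" using p by simp
  obtain q where q: "p = ereal q" "1 < q"
    using p by (cases p) (auto simp: one_ereal_def)
  obtain F where F: "finite F" "lp_le p (e / 2) (\<lambda>k. if k \<in> F then 0 else y k)"
    using lp_approx_finite_support[of q y "e / 2"] q y e by auto
  let ?t = "\<lambda>k. if k \<in> F then 0 else y k" and ?d = "\<lambda>m k. if k = m then 1 else (0::complex)"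
  define B where "B = (\<Sum>m\<in>F. norm (y m))"
  have dec: "y k = ?t k + (\<Sum>m\<in>F. y m * ?d m k)" for k
  proof (cases "k \<in> F")
    case True
    have "(\<Sum>m\<in>F. y m * ?d m k) = (\<Sum>m\<in>F. if m = k then y m else 0)"
      by (intro sum.cong) auto
    then show ?thesis using True F(1) by simp
  next
    case False
    then have "(\<Sum>m\<in>F. y m * ?d m k) = 0" by (intro sum.neutral) auto
    then show ?thesis using False by simp
  qed
  have mean: "shift_mean y n k = shift_mean ?t n k + (\<Sum>m\<in>F. y m * shift_mean (?d m) n k)" for n k
  proof -
    have "(\<Sum>j=1..n. y (k - int j)) = (\<Sum>j=1..n. ?t (k - int j)) + (\<Sum>j=1..n. \<Sum>m\<in>F. y m * ?d m (k - int j))"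
      by (subst dec) (rule sum.distrib)
    also have "(\<Sum>j=1..n. \<Sum>m\<in>F. y m * ?d m (k - int j)) = (\<Sum>m\<in>F. y m * (\<Sum>j=1..n. ?d m (k - int j)))"
      by (subst sum.swap) (simp only: sum_distrib_left)
    finally show ?thesis
      unfolding shift_mean_eq by (simp only: distrib_left sum_distrib_left mult.left_commute)
  qed
  have le: "lp_le p (e / 2 + B * real n powr (1 / q - 1)) (shift_mean y n)" for n
  proof -
    have d: "lp_le p (real n powr (1 / q - 1)) (shift_mean (?d m) n)" for m
      using q by (simp add: lp_le_shift_mean_delta)
    have "lp_le p (e / 2 + (\<Sum>m\<in>F. norm (y m) * real n powr (1 / q - 1)))
        (\<lambda>k. shift_mean ?t n k + (\<Sum>m\<in>F. y m * shift_mean (?d m) n k))"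
      by (intro lp_le_add lp_le_sum lp_le_mult p1 d lp_le_shift_mean[OF p1 F(2)])
    then show ?thesis
      by (simp add: mean[abs_def] B_def sum_distrib_right)
  qed
  have "1 / q - 1 < 0" using q by simp
  then have "(\<lambda>n. B * real n powr (1 / q - 1)) \<longlonglongrightarrow> 0"
    by (intro tendsto_mult_right_zero tendsto_neg_powr filterlim_real_sequentially)
  then obtain M where M: "\<And>n. n \<ge> M \<Longrightarrow> B * real n powr (1 / q - 1) < e / 2"
    using order_tendstoD(2)[of _ 0 sequentially "e / 2"] e
    by (force simp: eventually_sequentially)
  have "norm (lp_norm p (shift_mean y n) - 0) < e" if "n \<ge> M" for n
    using le[of n] M[OF that] lp_norm_nonneg[of "shift_mean y n" p] unfolding lp_le_def real_norm_def
    by linarith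
  then show "\<exists>M. \<forall>n\<ge>M. norm (lp_norm p (shift_mean y n) - 0) < e" by blast
qed

section \<open>Counterexamples for the two endpoint exponents\<close>

text \<open>Averaging a nonnegative sequence preserves its total mass, so the norm stays at least 1,
  while 0 is the only constant in the space.\<close>

lemma shift_mean_delta_not_convergent:
  "\<not> lp_tendsto 1 (shift_mean (\<lambda>k. if k = 0 then 1 else 0)) (\<lambda>_. c)"
proof
  let ?d = "\<lambda>k::int. if k = 0 then 1 else (0::complex)"
  assume l: "lp_tendsto 1 (shift_mean ?d) (\<lambda>_. c)"
  have c: "c = 0"
    using l lp_const_eq_zero[of 1 c] by (auto simp: lp_tendsto_def one_ereal_def)
  \<comment> \<open>The mean over one term is the unit mass moved one place to the right; shifting
    back gives membership.\<close>
  have "?d \<in> lp 1"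
    using lp_le_shift[OF _ lp_le_shift_mean_delta[of 1 1 0], of "-1"]
    by (simp add: shift_mean_eq one_ereal_def lp_le_def)
  then have m: "shift_mean ?d n \<in> lp 1" for n
    by (intro lp_shift_mean) auto
  have "1 \<le> lp_norm 1 (shift_mean ?d n)" if n: "0 < n" for n
  proof -
    have "(\<Sum>j=1..n. ?d (int i - int j)) = 1" if "i \<in> {1..n}" for i
    proof -
      have "(\<Sum>j=1..n. ?d (int i - int j)) = (\<Sum>j=1..n. if j = i then 1 else 0)"
        by (intro sum.cong) auto
      then show ?thesis using that by simp
    qed
    then have "(\<Sum>k\<in>int ` {1..n}. norm (shift_mean ?d n k)) = (\<Sum>i\<in>{1..n}. 1 / real n)"
      by (subst sum.reindex) (auto simp: shift_mean_eq norm_divide)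
    also have "\<dots> = 1" using n by simp
    finally have "1 \<le> real (card (int ` {1..n})) powr (1 - 1 / real_of_ereal 1) * lp_norm 1 (shift_mean ?d n)"
      using lp_le_sum_norm[OF _ lp_le_lp_norm[OF m], of "int ` {1..n}" n] n by simp
    then show ?thesis using n by (simp add: card_image)
  qed
  then have "\<forall>\<^sub>F n in sequentially. 1 \<le> lp_norm 1 (shift_mean ?d n)"
    by (rule eventually_mono[OF eventually_gt_at_top])
  moreover have "\<forall>\<^sub>F n in sequentially. lp_norm 1 (shift_mean ?d n) < 1"
    using l c order_tendstoD(2)[of _ 0 sequentially "1::real"] by (simp add: lp_tendsto_def)
  ultimately have "\<forall>\<^sub>F n :: nat in sequentially. False"
    by eventually_elim simp
  then show False by simp
qed

text \<open>Each mean takes the value 1 at site \<open>n\<close> and 0 at site 0, so no constant is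
  closer than 1/2 in the supremum norm.\<close>

lemma shift_mean_step_not_convergent:
  "\<not> lp_tendsto \<infinity> (shift_mean (\<lambda>k. if 0 \<le> k then 1 else 0)) (\<lambda>_. c)"
proof
  let ?h = "\<lambda>k::int. if 0 \<le> k then 1 else (0::complex)"
  assume l: "lp_tendsto \<infinity> (shift_mean ?h) (\<lambda>_. c)"
  have "lp_le \<infinity> 1 ?h" by (simp add: lp_le_infinity)
  then have "shift_mean ?h n \<in> lp \<infinity>" for n
    by (intro lp_shift_mean) (auto simp: lp_le_def)
  then have d: "lp_le \<infinity> (lp_norm \<infinity> (\<lambda>k. shift_mean ?h n k - c)) (\<lambda>k. shift_mean ?h n k - c)" for n
    using l by (intro lp_le_lp_norm lp_diff) (auto simp: lp_tendsto_def)
  have "\<forall>\<^sub>F n in sequentially. lp_norm \<infinity> (\<lambda>k. shift_mean ?h n k - c) < 1 / 2"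
    using l order_tendstoD(2)[of _ 0 sequentially "1 / 2::real"] by (simp add: lp_tendsto_def)
  then obtain n where n: "0 < n" "lp_norm \<infinity> (\<lambda>k. shift_mean ?h n k - c) < 1 / 2"
    using eventually_happens'[OF sequentially_bot eventually_conj[OF eventually_gt_at_top[of 0]]] by blast
  have "(\<Sum>j=1..n. ?h (int n - int j)) = (\<Sum>j=1..n. 1)"
    by (intro sum.cong) auto
  then have "shift_mean ?h n (int n) = 1"
    using n by (simp add: shift_mean_eq)
  moreover have "(\<Sum>j=1..n. ?h (0 - int j)) = 0"
    by (intro sum.neutral) auto
  then have "shift_mean ?h n 0 = 0"
    by (simp add: shift_mean_eq)
  ultimately have "norm (1 - c) < 1 / 2" "norm (0 - c) < 1 / 2"
    using norm_le_lp_le[OF _ d[of n], of "int n"] norm_le_lp_le[OF _ d[of n], of 0] n by simp_all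
  then show False
    using norm_triangle_ineq4[of "1 - c" "0 - c"] by simp
qed

lemma ex_lp_shift_mean_not_convergent:
  assumes p: "p = 1 \<or> p = \<infinity>"
  obtains y where "y \<in> lp p" "\<And>c. \<not> lp_tendsto p (shift_mean y) (\<lambda>_. c)"
  using p
proof
  assume [simp]: "p = 1"
  have "(\<lambda>k. if k = 0 then 1 else (0::complex)) \<in> lp p"
    using lp_le_shift[OF _ lp_le_shift_mean_delta[of 1 1 0], of "-1"]
    by (simp add: shift_mean_eq one_ereal_def lp_le_def)
  then show ?thesis
    using shift_mean_delta_not_convergent by (intro that) simp_all
next
  assume [simp]: "p = \<infinity>"
  have "lp_le \<infinity> 1 (\<lambda>k. if 0 \<le> k then 1 else (0::complex))" by (simp add: lp_le_infinity)
  then have "(\<lambda>k. if 0 \<le> k then 1 else (0::complex)) \<in> lp \<infinity>" unfolding lp_le_def ..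
  then show ?thesis
    using shift_mean_step_not_convergent by (intro that) simp_all
qed

section \<open>Optimality of the rates\<close>

text \<open>With zero second component, one application of \<open>half_shift\<close> leaves the
  first component unchanged, so the powers \<open>2 * i\<close> and \<open>Suc (2 * i)\<close> show
  the same shift.\<close>

lemma solution_first_component:
  assumes "\<alpha> \<noteq> 0"
  shows "solution \<alpha> (\<lambda>k. vector [y k, 0]) n k $ 1
    = (\<Sum>j\<le>n. of_real (Bernstein n j \<alpha>) * y (k - int (j div 2)))"
proof -
  let ?x = "\<lambda>k. vector [y k, 0] :: complex^2"
  have "(half_shift \<alpha> ^^ j) ?x k $ 1 = y (k - int (j div 2))" for j
  proof (cases "even j")
    case True
    then obtain i where "j = 2 * i" by blast
    then show ?thesis by (simp add: half_shift_funpow(1)[OF assms])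
  next
    case False
    then obtain i where "j = Suc (2 * i)" by (metis oddE Suc_eq_plus1)
    then show ?thesis
      by (simp add: half_shift_funpow(2)[OF assms] half_shift_def del: funpow.simps)
  qed
  then show ?thesis
    by (simp add: solution_Bernstein[OF assms] scaleR_conv_of_real[symmetric])
qed

text \<open>Chebyshev's inequality in signed form. If \<open>j\<close> is within
  \<open>sqrt n\<close> of its mean, \<open>j div 2\<close> lies in the window and its translate by
  \<open>M\<close> lies outside. The final bound is the expectation
  \<open>1 - 2 * \<alpha> * (1 - \<alpha>)\<close> of a quadratic minorant.\<close>

lemma Bernstein_window:
  fixes n M :: nat and \<alpha> :: real
  defines "I \<equiv> {\<lfloor>(real n * \<alpha> - sqrt (real n) - 1) / 2\<rfloor> + 1..\<lfloor>(real n * \<alpha> - sqrt (real n) - 1) / 2\<rfloor> + int M}"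
  assumes \<alpha>: "0 \<le> \<alpha>" "\<alpha> \<le> 1" and n: "0 < n" and M: "sqrt (real n) + 2 \<le> real M"
  shows "1 / 2 \<le> (\<Sum>j\<le>n. Bernstein n j \<alpha>
    * ((if int (j div 2) \<in> I then 1 else 0) - (if int (j div 2) + int M \<in> I then 1 else 0)))"
proof -
  define s where "s = sqrt (real n)"
  define a where "a = (real n * \<alpha> - s - 1) / 2"
  have I: "I = {\<lfloor>a\<rfloor> + 1..\<lfloor>a\<rfloor> + int M}" by (simp add: I_def a_def s_def)
  have s: "0 < s" "s\<^sup>2 = real n" using n by (auto simp: s_def)
  \<comment> \<open>The minorant is at most 1 everywhere, and at most -1 once \<open>j\<close> is
    \<open>sqrt n\<close> or more from its mean, where the difference of indicators may drop to
    -1.\<close>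
  have pw: "1 - 2 / real n * (real j - real n * \<alpha>)\<^sup>2
      \<le> (if int (j div 2) \<in> I then 1 else 0) - (if int (j div 2) + int M \<in> I then 1 else 0)" for j
  proof (cases "\<bar>real j - real n * \<alpha>\<bar> < s")
    case True
    have d: "real j - 1 \<le> 2 * real (j div 2)" "2 * real (j div 2) \<le> real j" by linarith+
    have fl: "real_of_int \<lfloor>a\<rfloor> \<le> a" "a < real_of_int \<lfloor>a\<rfloor> + 1" by linarith+
    have "real_of_int \<lfloor>a\<rfloor> < real (j div 2)"
      using True d fl by (simp add: a_def abs_less_iff field_simps)
    moreover have "real (j div 2) < real_of_int \<lfloor>a\<rfloor> + real M + 1"
      using True d fl(2) M by (simp add: a_def abs_less_iff field_simps s_def)
    ultimately have "int (j div 2) \<in> I" "\<not> int (j div 2) + int M \<in> I"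
      unfolding I by auto
    then show ?thesis using n by simp
  next
    case False
    have "s\<^sup>2 \<le> \<bar>real j - real n * \<alpha>\<bar>\<^sup>2"
      using False s by (intro power_mono) auto
    then have "2 / real n * real n \<le> 2 / real n * (real j - real n * \<alpha>)\<^sup>2"
      using s by (intro mult_left_mono) auto
    moreover have "2 / real n * real n = 2" using n by simp
    ultimately show ?thesis by (simp only: split: if_split) linarith
  qed
  have "\<alpha> * (1 - \<alpha>) \<le> 1 / 4"
    using zero_le_power2[of "\<alpha> - 1 / 2"] by (simp add: power2_eq_square algebra_simps)
  then have "1 / 2 \<le> 1 - 2 / real n * (real n * \<alpha> * (1 - \<alpha>))"
    using n by simp
  also have "\<dots> = (\<Sum>j\<le>n. Bernstein n j \<alpha>) - 2 / real n * (\<Sum>j\<le>n. Bernstein n j \<alpha> * (real j - real n * \<alpha>)\<^sup>2)"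
    by (simp add: Bernstein_variance)
  also have "\<dots> = (\<Sum>j\<le>n. Bernstein n j \<alpha> * (1 - 2 / real n * (real j - real n * \<alpha>)\<^sup>2))"
    by (simp add: sum_distrib_left sum_subtractf right_diff_distrib mult_ac)
  also have "\<dots> \<le> (\<Sum>j\<le>n. Bernstein n j \<alpha>
    * ((if int (j div 2) \<in> I then 1 else 0) - (if int (j div 2) + int M \<in> I then 1 else 0)))"
    by (intro sum_mono mult_left_mono pw Bernstein_nonneg \<alpha>)
  finally show ?thesis .
qed

lemma solution_block_lower_bound:
  fixes n M :: nat and W :: "int \<Rightarrow> complex" and \<omega> :: real
  defines "x \<equiv> (\<lambda>k. vector [W k - W (k - 1), 0] :: complex^2)"
  assumes \<alpha>: "0 < \<alpha>" "\<alpha> < 1" and p: "1 \<le> p" and n: "9 \<le> n"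
    and M: "sqrt (real n) + 2 \<le> real M" "M \<le> n" and x: "x \<in> lp p" and \<omega>: "0 \<le> \<omega>"
    and W: "\<And>k. 6 * int n \<le> k \<Longrightarrow> k \<le> 10 * int n \<Longrightarrow>
      W k = (if k \<in> {8 * int n..<8 * int n + int M} then of_real \<omega> else 0)"
  shows "\<omega> / 2 \<le> real M powr (1 - 1 / real_of_ereal p) * lp_norm p (solution \<alpha> x n)"
proof -
  define f where "f = \<lfloor>(real n * \<alpha> - sqrt (real n) - 1) / 2\<rfloor>"
  define I where "I = {f + 1..f + int M}"
  let ?sol = "solution \<alpha> x n"
  let ?b = "\<lambda>j. Bernstein n j \<alpha>"
  let ?m = "8 * int n"
  have nz: "\<alpha> \<noteq> 0" using \<alpha> by simp
  have sn: "0 \<le> sqrt (real n)" "sqrt (real n) \<le> real n"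
    using n by (auto intro: real_le_lsqrt simp: power2_eq_square)
  have na: "0 \<le> real n * \<alpha>" "real n * \<alpha> \<le> real n"
    using \<alpha> n by (auto simp: mult_le_cancel_left1)
  have M0: "0 < M" using M(1) sn by (cases M) auto
  have n1: "1 \<le> real n" using n by simp
  have f: "- int n \<le> f" "f \<le> int n"
  proof -
    have bounds: "- N \<le> (P - S - 1) / 2 \<and> (P - S - 1) / 2 < N + 1"
      if "0 \<le> S" "S \<le> N" "0 \<le> P" "P \<le> N" "1 \<le> N" for N P S :: real
      using that by (auto simp: field_simps)
    from bounds[OF sn na n1] show "- int n \<le> f" "f \<le> int n"
      unfolding f_def by (auto simp: le_floor_iff floor_le_iff)
  qed
  \<comment> \<open>The difference of a block is two opposite point masses, at its first site and
    just past its last.\<close>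
  have step: "W k - W (k - 1) = of_real (\<omega> * ((if k = ?m then 1 else 0) - (if k = ?m + int M then 1 else 0)))"
    if "6 * int n < k" "k \<le> 10 * int n" for k
    using M0 W[of k] W[of "k - 1"] that by auto
  have val: "?sol (?m + i) $ 1 = of_real (\<omega> * (\<Sum>j\<le>n. ?b j *
      ((if i = int (j div 2) then 1 else 0) - (if i = int (j div 2) + int M then 1 else 0))))"
    if i: "i \<in> I" for i
  proof -
    have "?sol (?m + i) $ 1 = (\<Sum>j\<le>n. of_real (?b j) * (W (?m + i - int (j div 2)) - W (?m + i - int (j div 2) - 1)))"
      unfolding x_def by (rule solution_first_component[OF nz])
    also have "\<dots> = (\<Sum>j\<le>n. of_real (?b j * (\<omega> *
       ((if i = int (j div 2) then 1 else 0) - (if i = int (j div 2) + int M then 1 else 0)))))"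
    proof (intro sum.cong refl)
      fix j assume "j \<in> {..n}"
      then have "int (j div 2) \<le> int n" by simp
      \<comment> \<open>Sites \<open>?m + i\<close> lie between \<open>7 * n\<close> and
        \<open>10 * n\<close> and lags are at most \<open>n\<close>, so only values of
        \<open>W\<close> prescribed by the hypothesis enter.\<close>
      then have "6 * int n < ?m + i - int (j div 2)" "?m + i - int (j div 2) \<le> 10 * int n"
        using i f M(2) by (auto simp: I_def)
      from step[OF this]
      show "of_real (?b j) * (W (?m + i - int (j div 2)) - W (?m + i - int (j div 2) - 1))
         = of_real (?b j * (\<omega> *
       ((if i = int (j div 2) then 1 else 0) - (if i = int (j div 2) + int M then 1 else 0))))"
        by auto
    qed
    finally show ?thesis
      by (simp add: sum_distrib_left mult.left_commute)
  qed
  have I: "finite I" "card I = M" "I \<noteq> {}"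
    using M0 by (auto simp: I_def)
  \<comment> \<open>Summing the solution over the window before taking norms turns the point masses
    into the window indicators.\<close>
  have "1 / 2 \<le> (\<Sum>j\<le>n. ?b j * ((if int (j div 2) \<in> I then 1 else 0) - (if int (j div 2) + int M \<in> I then 1 else 0)))"
    unfolding I_def f_def using \<alpha> n M(1) by (intro Bernstein_window) auto
  also have "\<dots> = (\<Sum>j\<le>n. ?b j * (\<Sum>i\<in>I. (if i = int (j div 2) then 1 else 0) - (if i = int (j div 2) + int M then 1 else 0)))"
    using I(1) by (simp add: sum_subtractf)
  also have "\<dots> = (\<Sum>i\<in>I. \<Sum>j\<le>n. ?b j * ((if i = int (j div 2) then 1 else 0) - (if i = int (j div 2) + int M then 1 else 0)))"
    unfolding sum_distrib_left by (rule sum.swap)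
  finally have "\<omega> * (1 / 2) \<le> \<omega> * \<dots>"
    using \<omega> by (rule mult_left_mono)
  also have "\<dots> \<le> \<bar>\<dots>\<bar>" by (rule abs_ge_self)
  also have "\<dots> = norm (\<Sum>i\<in>I. ?sol (?m + i) $ 1)"
    by (simp only: norm_of_real[symmetric, where 'a = complex] sum_distrib_left of_real_sum val cong: sum.cong)
  also have "\<dots> \<le> (\<Sum>i\<in>I. norm (?sol (?m + i) $ 1))" by (rule norm_sum)
  also have "\<dots> = (\<Sum>i\<in>(\<lambda>i. ?m + i) ` I. norm (?sol i $ 1))"
    by (subst sum.reindex) (auto simp: inj_on_def)
  also have "\<dots> \<le> real (card ((\<lambda>i. ?m + i) ` I)) powr (1 - 1 / real_of_ereal p) * lp_norm p ?sol"
    using I by (intro lp_le_sum_norm p lp_le_nth lp_le_lp_norm lp_solution x) auto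
  also have "card ((\<lambda>i. ?m + i) ` I) = M"
    using I by (subst card_image) (auto simp: inj_on_def)
  finally show ?thesis by simp
qed

section \<open>Superposition of blocks\<close>

text \<open>Block \<open>j\<close> contributes at most
  \<open>card (B j) * \<omega> j powr q \<le> (1 / 2) ^ j\<close>, a convergent geometric series.
  For \<open>p = \<infinity>\<close> the exponent is 0 by division by zero, and the same hypothesis
  bounds \<open>W\<close> by 1.\<close>

lemma lp_disjoint_blocks:
  fixes B :: "nat \<Rightarrow> int set" and \<omega> :: "nat \<Rightarrow> real" and W :: "int \<Rightarrow> 'a::real_normed_vector"
  assumes p: "1 \<le> p" and fin: "\<And>j. finite (B j)"
    and \<omega>: "\<And>j. 0 \<le> \<omega> j" "\<And>j. \<omega> j \<le> (1 / 2) ^ j * real (card (B j)) powr (- 1 / real_of_ereal p)"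
    and W: "\<And>k j. k \<in> B j \<Longrightarrow> norm (W k) = \<omega> j" and W0: "\<And>k. (\<forall>j. k \<notin> B j) \<Longrightarrow> W k = 0"
  shows "W \<in> lp p"
  using p
proof (cases rule: lp_exponent_cases)
  case 1
  have "norm (W k) \<le> 1" for k
  proof (cases "\<exists>j. k \<in> B j")
    case True
    then obtain j where j: "k \<in> B j" by blast
    then have c: "0 < card (B j)" using fin by (auto simp: card_gt_0_iff)
    have "(1 / 2 :: real) ^ j \<le> 1" by (simp add: power_le_one)
    then show ?thesis using W[OF j] \<omega>(2)[of j] c by (simp add: 1)
  qed (simp add: W0)
  then have "lp_le p 1 W" by (simp add: 1 lp_le_infinity)
  then show ?thesis by (simp add: lp_le_def)
next
  case (2 q)
  have "(\<Sum>k\<in>G. norm (W k) powr q) \<le> (2 powr (1 / q)) powr q" if G: "finite G" for G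
  proof -
    \<comment> \<open>One chosen index per point of \<open>G\<close> leaves finitely many blocks to
      sum over.\<close>
    define J where "J = (\<lambda>k. SOME j. k \<in> B j) ` {k \<in> G. \<exists>j. k \<in> B j}"
    have J: "finite J" using G by (simp add: J_def)
    have "(\<Sum>k\<in>G. norm (W k) powr q) \<le> (\<Sum>k\<in>G. \<Sum>j\<in>J. if k \<in> B j then \<omega> j powr q else 0)"
    proof (intro sum_mono)
      fix k assume k: "k \<in> G"
      show "norm (W k) powr q \<le> (\<Sum>j\<in>J. if k \<in> B j then \<omega> j powr q else 0)"
      proof (cases "\<exists>j. k \<in> B j")
        case True
        define j where "j = (SOME j. k \<in> B j)"
        have j: "k \<in> B j" unfolding j_def using True by (rule someI_ex)
        have "j \<in> J" using k True by (auto simp: J_def j_def)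
        then have "(if k \<in> B j then \<omega> j powr q else 0) \<le> (\<Sum>j\<in>J. if k \<in> B j then \<omega> j powr q else 0)"
          using J by (intro member_le_sum) auto
        then show ?thesis using j W by simp
      next
        case False
        then show ?thesis by (auto simp: W0 intro: sum_nonneg)
      qed
    qed
    also have "\<dots> = (\<Sum>j\<in>J. \<Sum>k\<in>G. if k \<in> B j then \<omega> j powr q else 0)"
      by (rule sum.swap)
    also have "\<dots> \<le> (\<Sum>j\<in>J. (1 / 2) ^ j)"
    proof (intro sum_mono)
      fix j
      have "(\<Sum>k\<in>G. if k \<in> B j then \<omega> j powr q else 0) = (\<Sum>k\<in>G \<inter> B j. \<omega> j powr q)"
        using G by (rule sum.inter_restrict[symmetric])
      also have "\<dots> \<le> (\<Sum>k\<in>B j. \<omega> j powr q)"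
        using fin by (intro sum_mono2) auto
      also have "\<dots> \<le> (1 / 2) ^ j"
      proof (cases "B j = {}")
        case False
        then have c: "0 < card (B j)" using fin by (auto simp: card_gt_0_iff)
        have "\<omega> j powr q \<le> ((1 / 2) ^ j * real (card (B j)) powr (- 1 / q)) powr q"
          using \<omega> 2 by (intro powr_mono2) auto
        also have "\<dots> = ((1 / 2) ^ j) powr q * (1 / real (card (B j)))"
          using 2 c by (simp only: powr_mult powr_powr) (simp add: powr_minus_divide)
        also have "((1 / 2 :: real) ^ j) powr q \<le> (1 / 2) ^ j"
          using powr_mono'[of 1 q "(1 / 2 :: real) ^ j"] 2 by (simp add: power_le_one)
        finally show ?thesis using c by (simp add: field_simps)
      qed simp
      finally show "(\<Sum>k\<in>G. if k \<in> B j then \<omega> j powr q else 0) \<le> (1 / 2) ^ j" .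
    qed
    also have "\<dots> \<le> (\<Sum>j. (1 / 2) ^ j)"
      using J by (intro sum_le_suminf) (auto intro: summable_geometric)
    also have "\<dots> = (2 :: real)"
      by (subst suminf_geometric) auto
    also have "2 = (2 powr (1 / q)) powr q"
      using 2 by (simp add: powr_powr)
    finally show ?thesis .
  qed
  then have "lp_le p (2 powr (1 / q)) W" using 2 by (simp add: lp_le_ereal)
  then show ?thesis by (simp add: lp_le_def)
qed

lemma coboundary_state_in_lp:
  fixes W :: "int \<Rightarrow> complex"
  assumes p: "1 \<le> p" and W: "W \<in> lp p"
  shows "(\<lambda>k. vector [W k - W (k - 1), 0] :: complex^2) \<in> lp p"
proof -
  have "lp_le p (lp_norm p W + lp_norm p W) (\<lambda>k. W k - W (k - 1))"
    by (rule lp_le_diff[OF p lp_le_lp_norm[OF W] lp_le_shift[OF p lp_le_lp_norm[OF W]]])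
  from lp_le_vector[OF p this lp_le_zero[OF p]] show ?thesis
    by (simp add: lp_le_def)
qed

text \<open>Doubling keeps the blocks apart, and \<open>j \<le> n j\<close> lets an eventual bound
  be used along the sequence.\<close>

lemma ex_growing_small_o:
  fixes r :: "nat \<Rightarrow> real"
  assumes r: "r \<in> o(\<lambda>n. real n powr (-1/2))"
  obtains n :: "nat \<Rightarrow> nat" where "\<And>j. 9 \<le> n j" "\<And>j. j \<le> n j" "\<And>j. 2 * n j \<le> n (Suc j)"
    "\<And>j. \<bar>r (n j)\<bar> \<le> (1 / 4) ^ j / sqrt (real (n j))"
proof -
  have ex: "\<exists>y. (9 \<le> y \<and> j \<le> y \<and> \<bar>r y\<bar> \<le> (1 / 4) ^ j / sqrt (real y)) \<and> b \<le> y" for j b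
  proof -
    have "\<forall>\<^sub>F n in sequentially. norm (r n) \<le> (1 / 4) ^ j * norm (real n powr (-1/2))"
      using r by (rule landau_o.smallD) simp
    then have "\<forall>\<^sub>F n in sequentially. norm (r n) \<le> (1 / 4) ^ j * norm (real n powr (-1/2))
        \<and> 9 \<le> n \<and> j \<le> n \<and> b \<le> n"
      by (intro eventually_conj eventually_ge_at_top)
    then obtain y where y: "norm (r y) \<le> (1 / 4) ^ j * norm (real y powr (-1/2))" "9 \<le> y" "j \<le> y" "b \<le> y"
      using eventually_happens'[OF sequentially_bot] by blast
    have "real y powr (-1/2) = 1 / sqrt (real y)"
      using y(2) by (simp add: powr_minus_divide powr_half_sqrt)
    with y show ?thesis by (intro exI[of _ y]) simp
  qed
  have "\<exists>n. \<forall>j. (9 \<le> n j \<and> j \<le> n j \<and> \<bar>r (n j)\<bar> \<le> (1 / 4) ^ j / sqrt (real (n j))) \<and> 2 * n j \<le> n (Suc j)"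
  proof (rule dependent_nat_choice)
    show "\<exists>y. 9 \<le> y \<and> 0 \<le> y \<and> \<bar>r y\<bar> \<le> (1 / 4) ^ 0 / sqrt (real y)"
      using ex[of 0 0] by blast
    show "\<exists>y. (9 \<le> y \<and> Suc j \<le> y \<and> \<bar>r y\<bar> \<le> (1 / 4) ^ Suc j / sqrt (real y)) \<and> 2 * x \<le> y" for x j :: nat
      by (rule ex)
  qed
  then show ?thesis using that by blast
qed

text \<open>The coboundary form of the initial state serves both optimality claims: its means are
  O(1/n), and it can be written as \<open>T x - x\<close>.\<close>

lemma ex_slow_solution:
  fixes r :: "nat \<Rightarrow> real"
  assumes \<alpha>: "0 < \<alpha>" "\<alpha> < 1" and p: "1 \<le> p" and r: "r \<in> o(\<lambda>n. real n powr (-1/2))"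
  obtains W where "W \<in> lp p"
    "(\<lambda>n. lp_norm p (solution \<alpha> (\<lambda>k. vector [W k - W (k - 1), 0]) n)) \<notin> O(r)"
proof -
  obtain n where n9: "\<And>j. 9 \<le> n j" and nj: "\<And>j. j \<le> n j" and n2: "\<And>j. 2 * n j \<le> n (Suc j)"
    and rn: "\<And>j. \<bar>r (n j)\<bar> \<le> (1 / 4) ^ j / sqrt (real (n j))"
    using ex_growing_small_o[OF r] by metis
  define e where "e = 1 / real_of_ereal p"
  \<comment> \<open>The window needs length \<open>sqrt n + 2\<close>. Since
    \<open>9 \<le> n j\<close>, rounding up still gives
    \<open>M j \<le> 2 * sqrt (n j) \<le> n j\<close>.\<close>
  define M where "M = (\<lambda>j. nat \<lceil>sqrt (real (n j))\<rceil> + 2)"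
  define B where "B = (\<lambda>j. {8 * int (n j)..<8 * int (n j) + int (M j)})"
  \<comment> \<open>Scaled so that block \<open>j\<close> has norm
    \<open>(1 / 2) ^ j\<close>.\<close>
  define \<omega> where "\<omega> = (\<lambda>j. (1 / 2) ^ j * real (M j) powr (- e))"
  define W where "W = (\<lambda>k. if \<exists>j. k \<in> B j then complex_of_real (\<omega> (SOME j. k \<in> B j)) else 0)"
  have \<omega>0: "0 \<le> \<omega> j" for j by (simp add: \<omega>_def)
  have npos: "0 < n j" for j using n9[of j] by simp
  have s3: "3 \<le> sqrt (real (n j))" for j
    using n9[of j] by (intro real_le_rsqrt) simp
  have sq: "sqrt (real (n j)) * 3 \<le> real (n j)" for j
    using mult_left_mono[OF s3[of j], of "sqrt (real (n j))"] by simp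
  have M1: "sqrt (real (n j)) + 2 \<le> real (M j)" for j
    unfolding M_def by (simp add: real_nat_ceiling_ge)
  have M2: "real (M j) \<le> 2 * sqrt (real (n j))" for j
    using s3[of j] unfolding M_def by (simp add: of_nat_nat) linarith
  have Mn: "M j \<le> n j" for j
    using M2[of j] sq[of j] s3[of j] by linarith
  have Mpos: "0 < M j" for j by (simp add: M_def)
  have sep: "2 * n i \<le> n j" if "i < j" for i j
    using that
  proof (induction j)
    case (Suc j)
    then show ?case using n2[of j] by (cases "i = j") auto
  qed simp
  \<comment> \<open>Block \<open>i\<close> lies between \<open>8 * n i\<close> and
    \<open>9 * n i\<close>. If \<open>n i\<close> is at least twice \<open>n j\<close> it starts
    beyond \<open>10 * n j\<close>; if at most half of it, it ends before \<open>6 * n j\<close>. So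
    the choice in \<open>W\<close> is harmless there.\<close>
  have unique: "i = j" if "6 * int (n j) \<le> k" "k \<le> 10 * int (n j)" "k \<in> B i" for i j k
    using that sep[of i j] sep[of j i] Mn[of i] n9[of i] n9[of j]
    by (cases i j rule: linorder_cases) (auto simp: B_def)
  have WB: "W k = (if k \<in> B j then of_real (\<omega> j) else 0)" if "6 * int (n j) \<le> k" "k \<le> 10 * int (n j)" for j k
  proof (cases "\<exists>i. k \<in> B i")
    case True
    then have "k \<in> B (SOME i. k \<in> B i)" by (rule someI_ex)
    then show ?thesis using unique[OF that] True by (auto simp: W_def)
  next
    case False
    then show ?thesis by (auto simp: W_def)
  qed
  have "W \<in> lp p"
  proof (rule lp_disjoint_blocks[OF p, of B \<omega>])
    show "finite (B j)" for j by (simp add: B_def)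
    show "0 \<le> \<omega> j" for j by (rule \<omega>0)
    show "\<omega> j \<le> (1 / 2) ^ j * real (card (B j)) powr (- 1 / real_of_ereal p)" for j
      by (simp add: \<omega>_def B_def e_def)
    show "norm (W k) = \<omega> j" if "k \<in> B j" for k j
    proof -
      have "6 * int (n j) \<le> k" "k \<le> 10 * int (n j)"
        using that Mn[of j] by (auto simp: B_def)
      then show ?thesis using that \<omega>0[of j] by (simp add: WB)
    qed
    show "W k = 0" if "\<forall>j. k \<notin> B j" for k
      using that by (simp add: W_def)
  qed
  define x where "x = (\<lambda>k. vector [W k - W (k - 1), 0] :: complex^2)"
  have x: "x \<in> lp p" unfolding x_def by (rule coboundary_state_in_lp[OF p \<open>W \<in> lp p\<close>])
  have lower: "(1 / 2) ^ j / (4 * sqrt (real (n j))) \<le> lp_norm p (solution \<alpha> x (n j))" for j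
  proof -
    have "\<omega> j / 2 \<le> real (M j) powr (1 - e) * lp_norm p (solution \<alpha> x (n j))"
      using WB[of j]
        solution_block_lower_bound[OF \<alpha> p n9[of j] M1[of j] Mn[of j] x[unfolded x_def] \<omega>0[of j]]
      unfolding x_def e_def B_def by blast
    also have "real (M j) powr (1 - e) = real (M j) * real (M j) powr (- e)"
      using Mpos[of j] powr_add[of "real (M j)" 1 "- e"] by simp
    finally have "real (M j) powr (- e) * ((1 / 2) ^ j / 2)
        \<le> real (M j) powr (- e) * (real (M j) * lp_norm p (solution \<alpha> x (n j)))"
      by (simp add: \<omega>_def mult_ac)
    then have "(1 / 2) ^ j / 2 \<le> real (M j) * lp_norm p (solution \<alpha> x (n j))"
      using Mpos[of j] by (simp add: mult_le_cancel_left_pos del: times_divide_eq_right)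
    also have "\<dots> \<le> 2 * sqrt (real (n j)) * lp_norm p (solution \<alpha> x (n j))"
      by (intro mult_right_mono M2 lp_norm_nonneg lp_solution p x)
    finally show ?thesis
      using npos[of j] by (simp add: field_simps)
  qed
  have "(\<lambda>m. lp_norm p (solution \<alpha> x m)) \<notin> O(r)"
  proof
    assume "(\<lambda>m. lp_norm p (solution \<alpha> x m)) \<in> O(r)"
    then obtain C where C: "0 < C" "\<forall>\<^sub>F m in sequentially. norm (lp_norm p (solution \<alpha> x m)) \<le> C * norm (r m)"
      by (elim landau_o.bigE)
    then obtain N where N: "\<And>m. N \<le> m \<Longrightarrow> norm (lp_norm p (solution \<alpha> x m)) \<le> C * norm (r m)"
      by (auto simp: eventually_sequentially)
    \<comment> \<open>At time \<open>n j\<close> the lower bound carries \<open>(1 / 2) ^ j\<close>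
      and the upper bound \<open>(1 / 4) ^ j\<close>; the factors \<open>sqrt (n j)\<close>
      cancel.\<close>
    have "2 ^ j \<le> 4 * C" if "N \<le> j" for j
    proof -
      have "N \<le> n j" using that nj[of j] by simp
      then have "(1 / 2) ^ j / (4 * sqrt (real (n j))) \<le> C * \<bar>r (n j)\<bar>"
        using lower[of j] N[of "n j"] by simp
      also have "\<dots> \<le> C * ((1 / 4) ^ j / sqrt (real (n j)))"
        using C rn by (intro mult_left_mono) auto
      finally have "(1 / 2) ^ j \<le> 4 * C * (1 / 4) ^ j"
        using npos[of j] by (simp add: field_simps)
      then have "4 ^ j * (1 / 2) ^ j \<le> 4 ^ j * (4 * C * (1 / 4) ^ j)"
        by (intro mult_left_mono) auto
      moreover have "(4::real) ^ j * (1 / 2) ^ j = 2 ^ j" "(4::real) ^ j * (1 / 4) ^ j = 1"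
        by (simp_all add: power_mult_distrib[symmetric])
      ultimately show ?thesis by (simp add: mult.left_commute)
    qed
    moreover obtain k where "4 * C < 2 ^ k"
      using real_arch_pow[of 2 "4 * C"] by auto
    moreover have "(2::real) ^ k \<le> 2 ^ max N k" by (intro power_increasing) auto
    ultimately show False by (metis max.cobounded1 not_le order_trans)
  qed
  with \<open>W \<in> lp p\<close> show ?thesis
    unfolding x_def by (rule that)
qed

section \<open>Failure of every faster rate\<close>

lemma optimal_solution_rate:
  fixes r :: "nat \<Rightarrow> real"
  assumes \<alpha>: "0 < \<alpha>" "\<alpha> < 1" and p: "1 \<le> p" and r: "r \<in> o(\<lambda>n. real n powr (-1/2))"
  obtains x where "x \<in> lp p"
    "(\<lambda>n. lp_norm p (\<lambda>k. shift_mean (first_component x) n k - 0)) \<in> O(\<lambda>n. 1 / real n)"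
    "(\<lambda>n. lp_norm p (\<lambda>k. solution \<alpha> x n k - limit_state \<alpha> 0 k)) \<notin> O(r)"
proof -
  obtain W where W: "W \<in> lp p"
    and slow: "(\<lambda>n. lp_norm p (solution \<alpha> (\<lambda>k. vector [W k - W (k - 1), 0]) n)) \<notin> O(r)"
    using ex_slow_solution[OF \<alpha> p r] .
  define x where "x = (\<lambda>k. vector [W k - W (k - 1), 0] :: complex^2)"
  have Wl: "lp_le p (lp_norm p W) W" using W by (rule lp_le_lp_norm)
  have x: "x \<in> lp p" unfolding x_def by (rule coboundary_state_in_lp[OF p W])
  have fx: "first_component x = (\<lambda>k. W k - W (k - 1))"
    by (simp add: x_def first_component_def)
  have "norm (lp_norm p (\<lambda>k. shift_mean (first_component x) n k - 0)) \<le> 2 * lp_norm p W * norm (1 / real n)" for n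
    using lp_le_shift_mean_coboundary[OF p Wl, of n]
      lp_norm_nonneg[of "shift_mean (\<lambda>k. W k - W (k - 1)) n" p]
    by (simp add: fx lp_le_def)
  then have "(\<lambda>n. lp_norm p (\<lambda>k. shift_mean (first_component x) n k - 0)) \<in> O(\<lambda>n. 1 / real n)"
    by (intro bigoI[of _ "2 * lp_norm p W"] always_eventually allI)
  moreover have "(\<lambda>k. solution \<alpha> x n k - limit_state \<alpha> 0 k) = solution \<alpha> x n" for n
    by (simp add: fun_eq_iff vec_eq_iff forall_2 limit_state_def)
  ultimately show ?thesis
    using slow x by (intro that[of x]) (simp_all add: x_def)
qed

lemma optimal_increment_rate:
  fixes r :: "nat \<Rightarrow> real"
  assumes \<alpha>: "0 < \<alpha>" "\<alpha> < 1" and p: "1 \<le> p" and r: "r \<in> o(\<lambda>n. real n powr (-1/2))"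
  obtains x where "x \<in> lp p"
    "(\<lambda>n. lp_norm p (\<lambda>k. solution \<alpha> x (n + 1) k - solution \<alpha> x n k)) \<notin> O(r)"
proof -
  obtain W where W: "W \<in> lp p"
    and slow: "(\<lambda>n. lp_norm p (solution \<alpha> (\<lambda>k. vector [W k - W (k - 1), 0]) n)) \<notin> O(r)"
    using ex_slow_solution[OF \<alpha> p r] .
  \<comment> \<open>This solves \<open>T x - x = (W - S W, 0)\<close>: the lower row forces the
    factor \<open>- 2 / \<alpha>\<close>, and the upper row is then the difference of the second
    component.\<close>
  define x where "x = (\<lambda>k. vector [- 2 / of_real \<alpha> * W k, W k] :: complex^2)"
  have Wl: "lp_le p (lp_norm p W) W" using W by (rule lp_le_lp_norm)
  have "lp_le p (norm (- 2 / of_real \<alpha> :: complex) * lp_norm p W + lp_norm p W) x"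
    unfolding x_def by (intro lp_le_vector lp_le_mult p Wl)
  then have x: "x \<in> lp p" by (simp add: lp_le_def)
  have "(\<lambda>k. T_op \<alpha> x k - x k) = (\<lambda>k. vector [W k - W (k - 1), 0])"
    using \<alpha> by (simp add: fun_eq_iff vec_eq_iff forall_2 T_op_nth x_def power2_eq_square algebra_simps)
  then have "solution \<alpha> (\<lambda>k. vector [W k - W (k - 1), 0]) n
      = (\<lambda>k. solution \<alpha> x (n + 1) k - solution \<alpha> x n k)" for n
    using solution_diff[of \<alpha> "T_op \<alpha> x" x n] by (simp add: solution_Suc)
  with slow x show ?thesis by (intro that[of x]) simp_all
qed

theorem corollary3p2:
  fixes \<alpha> :: real and p :: ereal
  assumes "0 < \<alpha>" and "\<alpha> < 1" and "1 \<le> p"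
  shows "(\<forall>x0 \<in> lp p.
        (\<exists>w. lp_tendsto p (solution \<alpha> x0) w) \<longleftrightarrow>
        (\<exists>c. lp_tendsto p (shift_mean (first_component x0)) (\<lambda>_. c))) \<and>
    (\<forall>x0 \<in> lp p. \<forall>c.
        lp_tendsto p (shift_mean (first_component x0)) (\<lambda>_. c) \<longrightarrow>
        lp_tendsto p (solution \<alpha> x0) (limit_state \<alpha> c)) \<and>
    ((\<forall>x0 \<in> lp p. \<exists>w. lp_tendsto p (solution \<alpha> x0) w) \<longleftrightarrow> 1 < p \<and> p < \<infinity>) \<and>
    (p < \<infinity> \<longrightarrow> (\<forall>c::complex. (\<lambda>_. c) \<in> lp p \<longrightarrow> c = 0)) \<and>
    (\<forall>x0 \<in> lp p. \<forall>c.
        (\<lambda>_. c) \<in> lp p \<and>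
        (\<lambda>n. lp_norm p (\<lambda>k. shift_mean (first_component x0) n k - c)) \<in> O(\<lambda>n. 1 / real n) \<longrightarrow>
        (\<lambda>n. lp_norm p (\<lambda>k. solution \<alpha> x0 n k - limit_state \<alpha> c k))
          \<in> O(\<lambda>n. real n powr (-1/2))) \<and>
    (\<forall>x0 \<in> lp p.
        (\<lambda>n. lp_norm p (\<lambda>k. solution \<alpha> x0 (n + 1) k - solution \<alpha> x0 n k))
          \<in> O(\<lambda>n. real n powr (-1/2))) \<and>
    (\<forall>r :: nat \<Rightarrow> real. (\<forall>n\<ge>1. 0 < r n) \<and> r \<in> o(\<lambda>n. real n powr (-1/2)) \<longrightarrow>
        \<not> (\<forall>x0 \<in> lp p. \<forall>c.
             (\<lambda>_. c) \<in> lp p \<and>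
             (\<lambda>n. lp_norm p (\<lambda>k. shift_mean (first_component x0) n k - c)) \<in> O(\<lambda>n. 1 / real n) \<longrightarrow>
             (\<lambda>n. lp_norm p (\<lambda>k. solution \<alpha> x0 n k - limit_state \<alpha> c k)) \<in> O(r))) \<and>
    (\<forall>r :: nat \<Rightarrow> real. (\<forall>n\<ge>1. 0 < r n) \<and> r \<in> o(\<lambda>n. real n powr (-1/2)) \<longrightarrow>
        \<not> (\<forall>x0 \<in> lp p.
             (\<lambda>n. lp_norm p (\<lambda>k. solution \<alpha> x0 (n + 1) k - solution \<alpha> x0 n k)) \<in> O(r)))"
proof -
  note \<alpha> = assms(1,2) and p = assms(3)
  have converges_iff: "(\<exists>w. lp_tendsto p (solution \<alpha> x0) w) \<longleftrightarrow>
      (\<exists>c. lp_tendsto p (shift_mean (first_component x0)) (\<lambda>_. c))" if "x0 \<in> lp p" for x0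
    using shift_mean_tendsto_of_solution[OF \<alpha>(1) p that]
      lp_tendsto_solution_limit_state[OF \<alpha> p that] by metis
  have all_converge_iff: "(\<forall>x0 \<in> lp p. \<exists>w. lp_tendsto p (solution \<alpha> x0) w) \<longleftrightarrow> 1 < p \<and> p < \<infinity>"
  proof
    assume all: "\<forall>x0 \<in> lp p. \<exists>w. lp_tendsto p (solution \<alpha> x0) w"
    show "1 < p \<and> p < \<infinity>"
    proof (rule ccontr)
      assume "\<not> (1 < p \<and> p < \<infinity>)"
      then have "p = 1 \<or> p = \<infinity>" using p by (auto simp: not_less)
      then obtain y where y: "y \<in> lp p" "\<And>c. \<not> lp_tendsto p (shift_mean y) (\<lambda>_. c)"
        using ex_lp_shift_mean_not_convergent by metis
      \<comment> \<open>Zero initial velocity turns a sequence with divergent means into an initial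
        state with a divergent solution.\<close>
      define x where "x = (\<lambda>k. vector [y k, 0] :: complex^2)"
      have "x \<in> lp p"
        using lp_le_vector[OF p lp_le_lp_norm[OF y(1)] lp_le_zero[OF p]] by (simp add: x_def lp_le_def)
      moreover have "first_component x = y" by (simp add: x_def first_component_def)
      ultimately show False using all converges_iff y(2) by metis
    qed
  next
    assume p1: "1 < p \<and> p < \<infinity>"
    show "\<forall>x0 \<in> lp p. \<exists>w. lp_tendsto p (solution \<alpha> x0) w"
    proof
      fix x0 :: "int \<Rightarrow> complex^2"
      assume x0: "x0 \<in> lp p"
      have "lp_tendsto p (shift_mean (first_component x0)) (\<lambda>_. 0)"
        using shift_mean_tendsto_zero_reflexive[of p "first_component x0"] p1 lp_first_component[OF p x0] zero_in_lp[OF p]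
        by (simp add: lp_tendsto_def)
      then show "\<exists>w. lp_tendsto p (solution \<alpha> x0) w" using converges_iff[OF x0] by blast
    qed
  qed
  have optimal_b: "\<not> (\<forall>x0 \<in> lp p. \<forall>c.
             (\<lambda>_. c) \<in> lp p \<and>
             (\<lambda>n. lp_norm p (\<lambda>k. shift_mean (first_component x0) n k - c)) \<in> O(\<lambda>n. 1 / real n) \<longrightarrow>
             (\<lambda>n. lp_norm p (\<lambda>k. solution \<alpha> x0 n k - limit_state \<alpha> c k)) \<in> O(r))"
    if r: "r \<in> o(\<lambda>n. real n powr (-1/2))" for r :: "nat \<Rightarrow> real"
  proof -
    obtain x where "x \<in> lp p"
      "(\<lambda>n. lp_norm p (\<lambda>k. shift_mean (first_component x) n k - 0)) \<in> O(\<lambda>n. 1 / real n)"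
      "(\<lambda>n. lp_norm p (\<lambda>k. solution \<alpha> x n k - limit_state \<alpha> 0 k)) \<notin> O(r)"
      using optimal_solution_rate[OF \<alpha> p r] .
    then show ?thesis using zero_in_lp[OF p, where 'a = complex] by blast
  qed
  have optimal_c: "\<not> (\<forall>x0 \<in> lp p.
             (\<lambda>n. lp_norm p (\<lambda>k. solution \<alpha> x0 (n + 1) k - solution \<alpha> x0 n k)) \<in> O(r))"
    if r: "r \<in> o(\<lambda>n. real n powr (-1/2))" for r :: "nat \<Rightarrow> real"
    by (rule optimal_increment_rate[OF \<alpha> p r]) blast
  show ?thesis
    by (intro conjI allI ballI impI converges_iff all_converge_iff
        lp_tendsto_solution_limit_state[OF \<alpha> p] lp_const_eq_zero[OF p] solution_rate[OF \<alpha> p]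
        solution_increment_bigo[OF \<alpha> p] optimal_b optimal_c) auto
qed

end
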